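(* Let $A$ be an associative ring with identity and let $\mathcal{F}_A$ be the class of all faithful (over $A$) partial $A$-groups. Then: (1) $\mathcal{F}_A$ is closed under direct products: if $G_i\in\mathcal{F}_A$ for all $i\in I$, then $\bigoplus_{i\in I}G_i\in\mathcal{F}_A$; (2) $\mathcal{F}_A$ is closed under direct limits: if $(G_i)_{i\in I}$ is a direct system (over a directed set) of groups $G_i\in\mathcal{F}_A$ and partial $A$-homomorphisms, then $\varinjlim G_i\in\mathcal{F}_A$.
   Context: An $A$-group is a group $G$ with a map $G\times A\to G$, $(g,\alpha)\mapsto g^\alpha$, such that for all $g,h\in G$, $\alpha,\beta\in A$: (1) $g^1=g$, $g^0=1$, $1^\alpha=1$; (2) $g^{\alpha+\beta}=g^\alpha g^\beta$, $g^{\alpha\beta}=(g^\alpha)^\beta$; (3) $(h^{-1}gh)^\alpha=h^{-1}g^\alpha h$; (4) $[g,h]=1$ implies $(gh)^\alpha=g^\alpha h^\alpha$. An $A$-homomorphism is a group homomorphism $f$ with $f(g^\alpha)=f(g)^\alpha$. A partial $A$-group is a group $G$ in which $g^\alpha$ is defined for some pairs $(g,\alpha)\in G\times A$, so that axioms (1)-(4) hold wherever the action is defined: $g^1=g$, $g^0=1$, $1^\alpha=1$; whenever the right-hand side of an equality in (2), (3), (4) is defined (with $[g,h]=1$ in (4)), so is the left-hand side and they are equal; and in (3) definedness of the left side also implies that of the right side. A partial $A$-homomorphism $f$ is a group homomorphism such that whenever $g^\alpha$ is defined, so is $f(g)^\alpha$, and $f(g^\alpha)=f(g)^\alpha$.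 A tensor $A$-completion of a partial $A$-group $G$ is an $A$-group $G^A$ with a partial $A$-homomorphism $\lambda:G\to G^A$ such that $\lambda(G)$ generates $G^A$ as an $A$-group and for every $A$-group $H$ and partial $A$-homomorphism $\varphi:G\to H$ there is a unique $A$-homomorphism $\psi:G^A\to H$ with $\psi\circ\lambda=\varphi$. It exists and is unique up to $A$-isomorphism. $G$ is called faithful (over $A$) if the canonical map $\lambda:G\to G^A$ is injective. The partial action on $\bigoplus G_i$ is coordinatewise (defined when it is defined in each coordinate); on $\varinjlim G_i$, $g^\alpha$ is defined when it is defined for some representative of $g$ in some $G_i$, its value being the image of that power. *)

theory Defs
  imports "HOL-Algebra.Algebra"
begin

section \<open>\<open>A\<close>-groups and partial \<open>A\<close>-groups\<close>

definition commutator :: "('g, 'm) monoid_scheme \<Rightarrow> 'g \<Rightarrow> 'g \<Rightarrow> 'g" where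
  "commutator G g h = inv\<^bsub>G\<^esub> g \<otimes>\<^bsub>G\<^esub> inv\<^bsub>G\<^esub> h \<otimes>\<^bsub>G\<^esub> g \<otimes>\<^bsub>G\<^esub> h"

record ('g, 'a) agroup = "'g monoid" +
  apow :: "'g \<Rightarrow> 'a \<Rightarrow> 'g"

locale A_group = A: ring A + G?: group G
  for A :: "('a, 'm) ring_scheme" and G :: "('g, 'a) agroup" +
  assumes apow_closed: "\<lbrakk>g \<in> carrier G; \<alpha> \<in> carrier A\<rbrakk> \<Longrightarrow> apow G g \<alpha> \<in> carrier G"
    and apow_one: "g \<in> carrier G \<Longrightarrow> apow G g \<one>\<^bsub>A\<^esub> = g"
    and apow_zero: "g \<in> carrier G \<Longrightarrow> apow G g \<zero>\<^bsub>A\<^esub> = \<one>\<^bsub>G\<^esub>"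
    and one_apow: "\<alpha> \<in> carrier A \<Longrightarrow> apow G \<one>\<^bsub>G\<^esub> \<alpha> = \<one>\<^bsub>G\<^esub>"
    and apow_add: "\<lbrakk>g \<in> carrier G; \<alpha> \<in> carrier A; \<beta> \<in> carrier A\<rbrakk>
      \<Longrightarrow> apow G g (\<alpha> \<oplus>\<^bsub>A\<^esub> \<beta>) = apow G g \<alpha> \<otimes>\<^bsub>G\<^esub> apow G g \<beta>"
    and apow_mult: "\<lbrakk>g \<in> carrier G; \<alpha> \<in> carrier A; \<beta> \<in> carrier A\<rbrakk>
      \<Longrightarrow> apow G g (\<alpha> \<otimes>\<^bsub>A\<^esub> \<beta>) = apow G (apow G g \<alpha>) \<beta>"
    and apow_conj: "\<lbrakk>g \<in> carrier G; h \<in> carrier G; \<alpha> \<in> carrier A\<rbrakk>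
      \<Longrightarrow> apow G (inv\<^bsub>G\<^esub> h \<otimes>\<^bsub>G\<^esub> g \<otimes>\<^bsub>G\<^esub> h) \<alpha> = inv\<^bsub>G\<^esub> h \<otimes>\<^bsub>G\<^esub> apow G g \<alpha> \<otimes>\<^bsub>G\<^esub> h"
    and apow_commute: "\<lbrakk>g \<in> carrier G; h \<in> carrier G; \<alpha> \<in> carrier A; commutator G g h = \<one>\<^bsub>G\<^esub>\<rbrakk>
      \<Longrightarrow> apow G (g \<otimes>\<^bsub>G\<^esub> h) \<alpha> = apow G g \<alpha> \<otimes>\<^bsub>G\<^esub> apow G h \<alpha>"

definition A_hom ::
  "('a, 'm) ring_scheme \<Rightarrow> ('g, 'a) agroup \<Rightarrow> ('h, 'a) agroup \<Rightarrow> ('g \<Rightarrow> 'h) set" where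
  "A_hom A G H = {f \<in> hom G H.
     \<forall>g \<in> carrier G. \<forall>\<alpha> \<in> carrier A. f (apow G g \<alpha>) = apow H (f g) \<alpha>}"

text \<open>The power \<open>g\<^sup>\<alpha>\<close> is undefined if \<^term>\<open>ppow G g \<alpha> = None\<close>. The powers \<open>g\<^sup>1\<close>, \<open>g\<^sup>0\<close> and
  \<open>1\<^sup>\<alpha>\<close> are always defined.\<close>

record ('g, 'a) pagroup = "'g monoid" +
  ppow :: "'g \<Rightarrow> 'a \<Rightarrow> 'g option"

locale partial_A_group = A: ring A + G?: group G
  for A :: "('a, 'm) ring_scheme" and G :: "('g, 'a) pagroup" +
  assumes ppow_closed: "\<lbrakk>g \<in> carrier G; \<alpha> \<in> carrier A; ppow G g \<alpha> = Some x\<rbrakk> \<Longrightarrow> x \<in> carrier G"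
    and ppow_one: "g \<in> carrier G \<Longrightarrow> ppow G g \<one>\<^bsub>A\<^esub> = Some g"
    and ppow_zero: "g \<in> carrier G \<Longrightarrow> ppow G g \<zero>\<^bsub>A\<^esub> = Some \<one>\<^bsub>G\<^esub>"
    and one_ppow: "\<alpha> \<in> carrier A \<Longrightarrow> ppow G \<one>\<^bsub>G\<^esub> \<alpha> = Some \<one>\<^bsub>G\<^esub>"
    and ppow_add: "\<lbrakk>g \<in> carrier G; \<alpha> \<in> carrier A; \<beta> \<in> carrier A;
        ppow G g \<alpha> = Some x; ppow G g \<beta> = Some y\<rbrakk>
      \<Longrightarrow> ppow G g (\<alpha> \<oplus>\<^bsub>A\<^esub> \<beta>) = Some (x \<otimes>\<^bsub>G\<^esub> y)"
    and ppow_mult: "\<lbrakk>g \<in> carrier G; \<alpha> \<in> carrier A; \<beta> \<in> carrier A;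
        ppow G g \<alpha> = Some x; ppow G x \<beta> = Some y\<rbrakk>
      \<Longrightarrow> ppow G g (\<alpha> \<otimes>\<^bsub>A\<^esub> \<beta>) = Some y"
    and ppow_conj: "\<lbrakk>g \<in> carrier G; h \<in> carrier G; \<alpha> \<in> carrier A; ppow G g \<alpha> = Some x\<rbrakk>
      \<Longrightarrow> ppow G (inv\<^bsub>G\<^esub> h \<otimes>\<^bsub>G\<^esub> g \<otimes>\<^bsub>G\<^esub> h) \<alpha> = Some (inv\<^bsub>G\<^esub> h \<otimes>\<^bsub>G\<^esub> x \<otimes>\<^bsub>G\<^esub> h)"
    and ppow_conj_defined: "\<lbrakk>g \<in> carrier G; h \<in> carrier G; \<alpha> \<in> carrier A;
        ppow G (inv\<^bsub>G\<^esub> h \<otimes>\<^bsub>G\<^esub> g \<otimes>\<^bsub>G\<^esub> h) \<alpha> \<noteq> None\<rbrakk> \<Longrightarrow> ppow G g \<alpha> \<noteq> None"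
    and ppow_commute: "\<lbrakk>g \<in> carrier G; h \<in> carrier G; \<alpha> \<in> carrier A; commutator G g h = \<one>\<^bsub>G\<^esub>;
        ppow G g \<alpha> = Some x; ppow G h \<alpha> = Some y\<rbrakk>
      \<Longrightarrow> ppow G (g \<otimes>\<^bsub>G\<^esub> h) \<alpha> = Some (x \<otimes>\<^bsub>G\<^esub> y)"

definition partial_A_hom ::
  "('a, 'm) ring_scheme \<Rightarrow> ('g, 'a) pagroup \<Rightarrow> ('h, 'a) pagroup \<Rightarrow> ('g \<Rightarrow> 'h) set" where
  "partial_A_hom A G H = {f \<in> hom G H.
     \<forall>g \<in> carrier G. \<forall>\<alpha> \<in> carrier A. \<forall>x. ppow G g \<alpha> = Some x \<longrightarrow> ppow H (f g) \<alpha> = Some (f x)}"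

definition as_partial :: "('g, 'a) agroup \<Rightarrow> ('g, 'a) pagroup" where
  "as_partial G = \<lparr>carrier = carrier G, monoid.mult = monoid.mult G, one = one G,
     ppow = (\<lambda>g \<alpha>. Some (apow G g \<alpha>))\<rparr>"

inductive_set A_generate :: "('a, 'm) ring_scheme \<Rightarrow> ('g, 'a) agroup \<Rightarrow> 'g set \<Rightarrow> 'g set"
  for A and G and S where
    one: "\<one>\<^bsub>G\<^esub> \<in> A_generate A G S"
  | incl: "g \<in> S \<Longrightarrow> g \<in> A_generate A G S"
  | inv: "g \<in> A_generate A G S \<Longrightarrow> inv\<^bsub>G\<^esub> g \<in> A_generate A G S"
  | mult: "\<lbrakk>g \<in> A_generate A G S; h \<in> A_generate A G S\<rbrakk> \<Longrightarrow> g \<otimes>\<^bsub>G\<^esub> h \<in> A_generate A G S"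
  | apow: "\<lbrakk>g \<in> A_generate A G S; \<alpha> \<in> carrier A\<rbrakk> \<Longrightarrow> apow G g \<alpha> \<in> A_generate A G S"


section \<open>Tensor completions and faithfulness\<close>

text \<open>The universal property is tested on all \<open>A\<close>-groups whose elements have type \<^typ>\<open>'h\<close>.
  Since maps are total functions, uniqueness of \<open>\<psi>\<close> means uniqueness on the carrier.\<close>

definition tensor_completion ::
  "'h itself \<Rightarrow> ('a, 'm) ring_scheme \<Rightarrow> ('g, 'a) pagroup \<Rightarrow> ('c, 'a) agroup \<Rightarrow> ('g \<Rightarrow> 'c) \<Rightarrow> bool"
  where
  "tensor_completion (_ :: 'h itself) A G C \<iota> \<longleftrightarrow>
     A_group A C \<and> \<iota> \<in> partial_A_hom A G (as_partial C) \<and>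
     A_generate A C (\<iota> ` carrier G) = carrier C \<and>
     (\<forall>(H :: ('h, 'a) agroup) \<phi>. A_group A H \<and> \<phi> \<in> partial_A_hom A G (as_partial H) \<longrightarrow>
        (\<exists>!\<psi>. \<psi> \<in> extensional (carrier C) \<and> \<psi> \<in> A_hom A C H \<and>
           (\<forall>g \<in> carrier G. \<psi> (\<iota> g) = \<phi> g)))"

datatype ('g, 'a) pow_term =
  Gen 'g
| One
| Inv "('g, 'a) pow_term"
| Mult "('g, 'a) pow_term" "('g, 'a) pow_term"
| Pow "('g, 'a) pow_term" 'a

text \<open>An \<open>A\<close>-group generated by an image of \<open>G\<close> is a quotient of the algebra of formal expressions
  over \<open>G\<close>, so up to isomorphism its elements are sets of such expressions. The type
  \<^typ>\<open>('g, 'a) pow_term set\<close> is therefore large enough both to contain a tensor completion and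
  to test its universal property; this is proved below.\<close>

definition faithful :: "('a, 'm) ring_scheme \<Rightarrow> ('g, 'a) pagroup \<Rightarrow> bool" where
  "faithful A G \<longleftrightarrow> (\<exists>(C :: (('g, 'a) pow_term set, 'a) agroup) \<iota>.
     tensor_completion TYPE(('g, 'a) pow_term set) A G C \<iota> \<and> inj_on \<iota> (carrier G))"

definition faithful_partial_A_groups :: "('a, 'm) ring_scheme \<Rightarrow> ('g, 'a) pagroup set" where
  "faithful_partial_A_groups A = {G. partial_A_group A G \<and> faithful A G}"


section \<open>Adequacy\<close>

lemma as_partial_simps [simp]:
  "carrier (as_partial G) = carrier G" "monoid.mult (as_partial G) = monoid.mult G"
  "one (as_partial G) = one G" "ppow (as_partial G) = (\<lambda>g \<alpha>. Some (apow G g \<alpha>))"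
  by (simp_all add: as_partial_def)

lemma partial_A_hom_as_partial_iff:
  "f \<in> partial_A_hom A G (as_partial H) \<longleftrightarrow> f \<in> hom G H \<and>
     (\<forall>g \<in> carrier G. \<forall>\<alpha> \<in> carrier A. \<forall>x. ppow G g \<alpha> = Some x \<longrightarrow> f x = apow H (f g) \<alpha>)"
  by (auto simp: partial_A_hom_def hom_def)

lemma commutator_eq_one_iff:
  assumes "group G" "g \<in> carrier G" "h \<in> carrier G"
  shows "commutator G g h = \<one>\<^bsub>G\<^esub> \<longleftrightarrow> g \<otimes>\<^bsub>G\<^esub> h = h \<otimes>\<^bsub>G\<^esub> g"
proof -
  interpret group G by fact
  have "commutator G g h = inv\<^bsub>G\<^esub> (h \<otimes>\<^bsub>G\<^esub> g) \<otimes>\<^bsub>G\<^esub> (g \<otimes>\<^bsub>G\<^esub> h)"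
    using assms by (simp add: commutator_def inv_mult_group m_assoc)
  then show ?thesis
    using assms by (metis inv_closed inv_inv inv_equality l_inv m_closed)
qed

lemma A_group_embedded:
  assumes H: "A_group A H" and K: "group K"
    and hom: "e \<in> hom K H" and inj: "inj_on e (carrier K)"
    and closed: "\<And>g \<alpha>. g \<in> carrier K \<Longrightarrow> \<alpha> \<in> carrier A \<Longrightarrow> apow K g \<alpha> \<in> carrier K"
    and pow: "\<And>g \<alpha>. g \<in> carrier K \<Longrightarrow> \<alpha> \<in> carrier A \<Longrightarrow> e (apow K g \<alpha>) = apow H (e g) \<alpha>"
  shows "A_group A K"
proof -
  interpret H: A_group A H by fact
  interpret K: group K by fact
  interpret e: group_hom K H e
    by (simp add: group_hom.intro group_hom_axioms.intro hom H.group_axioms K)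
  have eqI: "x = y" if "e x = e y" "x \<in> carrier K" "y \<in> carrier K" for x y
    using that inj by (auto dest: inj_onD)
  show ?thesis
  proof (unfold_locales, goal_cases)
    case (1 g \<alpha>) then show ?case by (rule closed)
  next
    case (2 g) then show ?case by (intro eqI) (auto simp: pow closed H.apow_one)
  next
    case (3 g) then show ?case by (intro eqI) (auto simp: pow closed H.apow_zero)
  next
    case (4 \<alpha>) then show ?case by (intro eqI) (auto simp: pow closed H.one_apow)
  next
    case (5 g \<alpha> \<beta>) then show ?case by (intro eqI) (auto simp: pow closed H.apow_add)
  next
    case (6 g \<alpha> \<beta>) then show ?case by (intro eqI) (auto simp: pow closed H.apow_mult)
  next
    case (7 g h \<alpha>) then show ?case by (intro eqI) (auto simp: pow closed H.apow_conj)
  next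
    case (8 g h \<alpha>)
    then have "g \<otimes>\<^bsub>K\<^esub> h = h \<otimes>\<^bsub>K\<^esub> g"
      by (simp add: commutator_eq_one_iff K)
    then have "e g \<otimes>\<^bsub>H\<^esub> e h = e h \<otimes>\<^bsub>H\<^esub> e g"
      using 8 by (metis e.hom_mult)
    then have "commutator H (e g) (e h) = \<one>\<^bsub>H\<^esub>"
      using 8 by (simp add: commutator_eq_one_iff H.group_axioms)
    with 8 show ?case by (intro eqI) (auto simp: pow closed H.apow_commute)
  qed
qed

context A_group
begin

lemma A_generate_subset:
  assumes "S \<subseteq> carrier G" shows "A_generate A G S \<subseteq> carrier G"
proof
  fix x assume "x \<in> A_generate A G S"
  then show "x \<in> carrier G"
    by induction (use assms in \<open>auto simp: apow_closed\<close>)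
qed

lemma A_generate_subgroup:
  assumes "S \<subseteq> carrier G" shows "subgroup (A_generate A G S) G"
  using A_generate_subset[OF assms]
  by (intro subgroup.intro) (auto intro: A_generate.intros)

end

lemma A_hom_eq_on_generated:
  assumes C: "A_group A C" and H: "A_group A H" and S: "S \<subseteq> carrier C"
    and f: "f \<in> A_hom A C H" and g: "g \<in> A_hom A C H"
    and eq: "\<And>x. x \<in> S \<Longrightarrow> f x = g x" and x: "x \<in> A_generate A C S"
  shows "f x = g x"
proof -
  interpret C: A_group A C by fact
  interpret H: A_group A H by fact
  interpret f: group_hom C H f
    using f by (simp add: group_hom.intro group_hom_axioms.intro A_hom_def C.group_axioms H.group_axioms)
  interpret g: group_hom C H g
    using g by (simp add: group_hom.intro group_hom_axioms.intro A_hom_def C.group_axioms H.group_axioms)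
  have sub: "A_generate A C S \<subseteq> carrier C"
    by (rule C.A_generate_subset[OF S])
  from x show ?thesis
    by induction (use sub f g eq in \<open>auto simp: A_hom_def subset_iff\<close>)
qed

lemma A_hom_generate_image:
  assumes C: "A_group A C" and H: "A_group A H" and S: "S \<subseteq> carrier C"
    and f: "f \<in> A_hom A C H" and x: "x \<in> A_generate A C S"
  shows "f x \<in> A_generate A H (f ` S)"
proof -
  interpret C: A_group A C by fact
  interpret H: A_group A H by fact
  interpret f: group_hom C H f
    using f by (simp add: group_hom.intro group_hom_axioms.intro A_hom_def C.group_axioms H.group_axioms)
  have sub: "A_generate A C S \<subseteq> carrier C"
    by (rule C.A_generate_subset[OF S])
  from x show ?thesis
    by induction (use sub f in \<open>auto simp: A_hom_def subset_iff intro: A_generate.intros\<close>)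
qed

lemma A_hom_comp:
  assumes "f \<in> A_hom A G H" "g \<in> A_hom A H K"
  shows "g \<circ> f \<in> A_hom A G K"
  using assms by (auto simp: A_hom_def hom_def Pi_iff)

lemma A_hom_restrict:
  assumes "A_group A G" "f \<in> A_hom A G H"
  shows "restrict f (carrier G) \<in> A_hom A G H"
proof -
  interpret A_group A G by fact
  show ?thesis using assms(2) by (auto simp: A_hom_def hom_def Pi_iff apow_closed)
qed

lemma partial_A_hom_comp_A_hom:
  assumes "f \<in> partial_A_hom A G (as_partial H)" "e \<in> A_hom A H K"
  shows "e \<circ> f \<in> partial_A_hom A G (as_partial K)"
  using assms by (auto simp: partial_A_hom_as_partial_iff A_hom_def hom_def Pi_iff)

primrec term_value :: "('h, 'a) agroup \<Rightarrow> ('g \<Rightarrow> 'h) \<Rightarrow> ('g, 'a) pow_term \<Rightarrow> 'h" where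
  "term_value H \<phi> (Gen g) = \<phi> g"
| "term_value H \<phi> One = \<one>\<^bsub>H\<^esub>"
| "term_value H \<phi> (Inv s) = inv\<^bsub>H\<^esub> term_value H \<phi> s"
| "term_value H \<phi> (Mult s t) = term_value H \<phi> s \<otimes>\<^bsub>H\<^esub> term_value H \<phi> t"
| "term_value H \<phi> (Pow s \<alpha>) = apow H (term_value H \<phi> s) \<alpha>"

lemma A_generate_term_value:
  assumes "x \<in> A_generate A H (\<phi> ` U)"
  shows "x \<in> range (term_value H \<phi>)"
  using assms
proof induction
  case one show ?case by (rule range_eqI[of _ _ One]) simp
next
  case (incl g)
  then obtain x where "g = \<phi> x" by auto
  then show ?case by (intro range_eqI[of _ _ "Gen x"]) simp
next
  case (inv g)
  then obtain s where "g = term_value H \<phi> s" by auto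
  then show ?case by (intro range_eqI[of _ _ "pow_term.Inv s"]) simp
next
  case (mult g h)
  then obtain s t where "g = term_value H \<phi> s" "h = term_value H \<phi> t" by auto
  then show ?case by (intro range_eqI[of _ _ "Mult s t"]) simp
next
  case (apow g \<alpha>)
  then obtain s where "g = term_value H \<phi> s" by auto
  then show ?case by (intro range_eqI[of _ _ "Pow s \<alpha>"]) simp
qed

text \<open>The \<open>A\<close>-subgroup generated by the image of \<open>G\<close> has an isomorphic copy on the type
  \<^typ>\<open>('g, 'a) pow_term set\<close>.\<close>

lemma generated_copy:
  fixes G :: "('g, 'a) pagroup" and H :: "('h, 'a) agroup"
  assumes H: "A_group A H" and \<phi>: "\<phi> \<in> partial_A_hom A G (as_partial H)"
    and G: "partial_A_group A G"
  obtains K :: "(('g, 'a) pow_term set, 'a) agroup" and \<phi>' e where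
    "A_group A K" "\<phi>' \<in> partial_A_hom A G (as_partial K)"
    "A_generate A K (\<phi>' ` carrier G) = carrier K"
    "e \<in> A_hom A K H" "inj_on e (carrier K)" "\<And>g. g \<in> carrier G \<Longrightarrow> e (\<phi>' g) = \<phi> g"
proof -
  interpret H: A_group A H by fact
  interpret G: partial_A_group A G by fact
  define M where "M = A_generate A H (\<phi> ` carrier G)"
  define j where "j = (\<lambda>x. {t :: ('g, 'a) pow_term. term_value H \<phi> t = x})"
  define e where "e = inv_into M j"
  have \<phi>_carrier: "\<phi> ` carrier G \<subseteq> carrier H"
    using \<phi> by (auto simp: partial_A_hom_as_partial_iff hom_def)
  have M: "subgroup M H"
    unfolding M_def by (rule H.A_generate_subgroup[OF \<phi>_carrier])
  have Mpow: "apow H x \<alpha> \<in> M" if "x \<in> M" "\<alpha> \<in> carrier A" for x \<alpha>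
    using that unfolding M_def by (rule A_generate.apow)
  have \<phi>M: "\<phi> g \<in> M" if "g \<in> carrier G" for g
    using that unfolding M_def by (auto intro: A_generate.incl)
  have Msub: "x \<in> carrier H" if "x \<in> M" for x
    using that M subgroup.subset by blast
  have Mmult: "x \<otimes>\<^bsub>H\<^esub> y \<in> M" if "x \<in> M" "y \<in> M" for x y
    using that by (rule subgroup.m_closed[OF M])
  have Mone: "\<one>\<^bsub>H\<^esub> \<in> M" by (rule subgroup.one_closed[OF M])
  have Minv: "inv\<^bsub>H\<^esub> x \<in> M" if "x \<in> M" for x
    using that by (rule subgroup.m_inv_closed[OF M])
  have j_inj: "inj_on j M"
  proof (rule inj_onI)
    fix x y assume "x \<in> M" "y \<in> M" and eq: "j x = j y"
    from \<open>x \<in> M\<close> obtain t where "x = term_value H \<phi> t"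
      using A_generate_term_value unfolding M_def by fastforce
    then have "t \<in> j y" using eq by (auto simp: j_def)
    then show "x = y" using \<open>x = _\<close> by (simp add: j_def)
  qed
  have ej [simp]: "e (j x) = x" if "x \<in> M" for x
    using that j_inj by (simp add: e_def)
  define K :: "(('g, 'a) pow_term set, 'a) agroup" where
    "K = \<lparr>carrier = j ` M, monoid.mult = (\<lambda>U V. j (e U \<otimes>\<^bsub>H\<^esub> e V)), one = j \<one>\<^bsub>H\<^esub>,
          apow = (\<lambda>U \<alpha>. j (apow H (e U) \<alpha>))\<rparr>"
  have K_simps [simp]: "carrier K = j ` M" "x \<otimes>\<^bsub>K\<^esub> y = j (e x \<otimes>\<^bsub>H\<^esub> e y)" "\<one>\<^bsub>K\<^esub> = j \<one>\<^bsub>H\<^esub>"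
    "apow K x \<alpha> = j (apow H (e x) \<alpha>)" for x y \<alpha>
    by (simp_all add: K_def)
  have K_group: "group K"
  proof (rule groupI)
    fix x assume "x \<in> carrier K"
    then obtain m where m: "m \<in> M" "x = j m" by auto
    have "j (inv\<^bsub>H\<^esub> m) \<in> carrier K" "j (inv\<^bsub>H\<^esub> m) \<otimes>\<^bsub>K\<^esub> x = \<one>\<^bsub>K\<^esub>"
      using m Minv by (auto simp: Msub)
    then show "\<exists>y\<in>carrier K. y \<otimes>\<^bsub>K\<^esub> x = \<one>\<^bsub>K\<^esub>" by blast
  qed (auto simp: Mmult Mone Msub H.m_assoc)
  have e_hom: "e \<in> hom K H"
    by (auto simp: hom_def Mmult Msub)
  have e_inj: "inj_on e (carrier K)"
    by (auto simp: inj_on_def)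
  have K: "A_group A K"
    by (rule A_group_embedded[OF H K_group e_hom e_inj]) (auto simp: Mpow)
  interpret K: A_group A K by (rule K)
  have e_A_hom: "e \<in> A_hom A K H"
    using e_hom by (auto simp: A_hom_def Mpow)
  have closed: "x \<in> carrier G" if "g \<in> carrier G" "\<alpha> \<in> carrier A" "ppow G g \<alpha> = Some x" for g \<alpha> x
    using that by (rule G.ppow_closed)
  have \<phi>': "(j \<circ> \<phi>) \<in> partial_A_hom A G (as_partial K)"
    using \<phi> by (auto simp: partial_A_hom_as_partial_iff hom_def \<phi>M)
  have sub: "(j \<circ> \<phi>) ` carrier G \<subseteq> carrier K"
    by (auto simp: \<phi>M)
  have jinv: "inv\<^bsub>K\<^esub> (j m) = j (inv\<^bsub>H\<^esub> m)" if "m \<in> M" for m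
    by (rule K.inv_equality) (use that Minv in \<open>auto simp: Msub\<close>)
  have "j x \<in> A_generate A K ((j \<circ> \<phi>) ` carrier G) \<and> x \<in> M"
    if "x \<in> A_generate A H (\<phi> ` carrier G)" for x
    using that
  proof induction
    case one
    then show ?case using A_generate.one[of K A] Mone by simp
  next
    case (incl g)
    then show ?case by (auto intro: A_generate.incl \<phi>M)
  next
    case (inv g)
    then show ?case using A_generate.inv[of "j g" A K] jinv Minv by auto
  next
    case (mult g h)
    then show ?case using A_generate.mult[of "j g" A K _ "j h"] Mmult by auto
  next
    case (apow g \<alpha>)
    then show ?case using A_generate.apow[of "j g" A K _ \<alpha>] Mpow by auto
  qed
  then have "A_generate A K ((j \<circ> \<phi>) ` carrier G) = carrier K"
    using K.A_generate_subset[OF sub] by (auto simp: M_def)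
  with K \<phi>' e_A_hom e_inj \<phi>M show ?thesis
    by (intro that[of K "j \<circ> \<phi>" e]) auto
qed

lemma tensor_completionD:
  assumes "tensor_completion TYPE('h) A G (C :: ('c, 'a) agroup) \<iota>"
  shows "A_group A C" "\<iota> \<in> partial_A_hom A G (as_partial C)"
    "A_generate A C (\<iota> ` carrier G) = carrier C"
    "\<iota> ` carrier G \<subseteq> carrier C"
  using assms by (auto simp: tensor_completion_def partial_A_hom_as_partial_iff hom_def)

lemma tensor_completion_lift:
  fixes C :: "('c, 'a) agroup" and H :: "('h, 'a) agroup"
  assumes "tensor_completion TYPE('h) A G C \<iota>" "A_group A H"
    "\<phi> \<in> partial_A_hom A G (as_partial H)"
  obtains \<psi> where "\<psi> \<in> A_hom A C H" "\<And>g. g \<in> carrier G \<Longrightarrow> \<psi> (\<iota> g) = \<phi> g"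
proof -
  from assms have "\<exists>!\<psi>. \<psi> \<in> extensional (carrier C) \<and> \<psi> \<in> A_hom A C H \<and>
      (\<forall>g \<in> carrier G. \<psi> (\<iota> g) = \<phi> g)"
    by (simp add: tensor_completion_def)
  then show ?thesis using that by (blast dest: ex1_implies_ex)
qed

lemma tensor_completionI:
  fixes C :: "('c, 'a) agroup" and G :: "('g, 'a) pagroup"
  assumes C: "A_group A C" and \<iota>: "\<iota> \<in> partial_A_hom A G (as_partial C)"
    and gen: "A_generate A C (\<iota> ` carrier G) = carrier C"
    and lift: "\<And>(H :: ('h, 'a) agroup) \<phi>. A_group A H \<Longrightarrow> \<phi> \<in> partial_A_hom A G (as_partial H)
      \<Longrightarrow> \<exists>\<psi> \<in> A_hom A C H. \<forall>g \<in> carrier G. \<psi> (\<iota> g) = \<phi> g"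
  shows "tensor_completion TYPE('h) A G C \<iota>"
  unfolding tensor_completion_def
proof (intro conjI allI impI C \<iota> gen)
  fix H :: "('h, 'a) agroup" and \<phi>
  assume "A_group A H \<and> \<phi> \<in> partial_A_hom A G (as_partial H)"
  then have H: "A_group A H" and \<phi>: "\<phi> \<in> partial_A_hom A G (as_partial H)" by auto
  have sub: "\<iota> ` carrier G \<subseteq> carrier C"
    using \<iota> by (auto simp: partial_A_hom_as_partial_iff hom_def)
  obtain \<psi> where \<psi>: "\<psi> \<in> A_hom A C H" "\<forall>g \<in> carrier G. \<psi> (\<iota> g) = \<phi> g"
    using lift[OF H \<phi>] by auto
  show "\<exists>!\<psi>. \<psi> \<in> extensional (carrier C) \<and> \<psi> \<in> A_hom A C H \<and>
      (\<forall>g \<in> carrier G. \<psi> (\<iota> g) = \<phi> g)"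
  proof (rule ex1I[of _ "restrict \<psi> (carrier C)"])
    show "restrict \<psi> (carrier C) \<in> extensional (carrier C) \<and>
        restrict \<psi> (carrier C) \<in> A_hom A C H \<and>
        (\<forall>g \<in> carrier G. restrict \<psi> (carrier C) (\<iota> g) = \<phi> g)"
      using \<psi> sub A_hom_restrict[OF C] by auto
  next
    fix \<chi> assume \<chi>: "\<chi> \<in> extensional (carrier C) \<and> \<chi> \<in> A_hom A C H \<and>
      (\<forall>g \<in> carrier G. \<chi> (\<iota> g) = \<phi> g)"
    have "\<chi> x = \<psi> x" if "x \<in> carrier C" for x
    proof (rule A_hom_eq_on_generated[OF C H sub])
      show "x \<in> A_generate A C (\<iota> ` carrier G)" using that gen by simp
    qed (use \<chi> \<psi> in auto)
    then show "\<chi> = restrict \<psi> (carrier C)"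
      using \<chi> by (auto intro!: extensionalityI[of _ "carrier C"])
  qed
qed

theorem tensor_completion_any_type:
  fixes G :: "('g, 'a) pagroup" and C :: "('c, 'a) agroup"
  assumes G: "partial_A_group A G"
    and C: "tensor_completion TYPE(('g, 'a) pow_term set) A G C \<iota>"
  shows "tensor_completion TYPE('h) A G C \<iota>"
proof (rule tensor_completionI)
  fix H :: "('h, 'a) agroup" and \<phi>
  assume H: "A_group A H" and \<phi>: "\<phi> \<in> partial_A_hom A G (as_partial H)"
  obtain K :: "(('g, 'a) pow_term set, 'a) agroup" and \<phi>' e where
    K: "A_group A K" "\<phi>' \<in> partial_A_hom A G (as_partial K)"
    "e \<in> A_hom A K H" "\<And>g. g \<in> carrier G \<Longrightarrow> e (\<phi>' g) = \<phi> g"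
    using generated_copy[OF H \<phi> G] by metis
  obtain \<psi> where "\<psi> \<in> A_hom A C K" "\<And>g. g \<in> carrier G \<Longrightarrow> \<psi> (\<iota> g) = \<phi>' g"
    using tensor_completion_lift[OF C K(1,2)] by metis
  then show "\<exists>\<psi> \<in> A_hom A C H. \<forall>g \<in> carrier G. \<psi> (\<iota> g) = \<phi> g"
    using K by (intro bexI[of _ "e \<circ> \<psi>"]) (auto intro: A_hom_comp)
qed (use tensor_completionD[OF C] in auto)

definition product_agroup :: "'i set \<Rightarrow> ('i \<Rightarrow> ('g, 'a) agroup) \<Rightarrow> ('i \<Rightarrow> 'g, 'a) agroup" where
  "product_agroup I G = \<lparr>carrier = carrier (product_group I G),
     monoid.mult = monoid.mult (product_group I G), one = one (product_group I G),
     apow = (\<lambda>x \<alpha>. \<lambda>i\<in>I. apow (G i) (x i) \<alpha>)\<rparr>"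

lemma product_agroup_simps [simp]:
  "carrier (product_agroup I G) = (\<Pi>\<^sub>E i\<in>I. carrier (G i))"
  "monoid.mult (product_agroup I G) = (\<lambda>x y. \<lambda>i\<in>I. x i \<otimes>\<^bsub>G i\<^esub> y i)"
  "one (product_agroup I G) = (\<lambda>i\<in>I. \<one>\<^bsub>G i\<^esub>)"
  "apow (product_agroup I G) = (\<lambda>x \<alpha>. \<lambda>i\<in>I. apow (G i) (x i) \<alpha>)"
  by (simp_all add: product_agroup_def)

lemma A_group_product:
  assumes A: "ring A" and G: "\<And>i. i \<in> I \<Longrightarrow> A_group A (G i)"
  shows "A_group A (product_agroup I G)"
proof -
  have grp: "group (G i)" if "i \<in> I" for i
    using G[OF that] by (simp add: A_group_def)
  have pg: "group (product_group I G)"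
    by (simp add: grp)
  interpret pg: group "product_group I G" by (rule pg)
  have P: "group (product_agroup I G)"
  proof (rule groupI)
    fix x assume "x \<in> carrier (product_agroup I G)"
    then show "\<exists>y\<in>carrier (product_agroup I G). y \<otimes>\<^bsub>product_agroup I G\<^esub> x = \<one>\<^bsub>product_agroup I G\<^esub>"
      using pg.l_inv_ex[of x] by (auto simp: product_agroup_def)
  qed (use pg.m_closed pg.one_closed pg.m_assoc pg.l_one in
      \<open>simp_all add: product_agroup_def del: carrier_product_group mult_product_group one_product_group\<close>)
  interpret A: ring A by fact
  interpret P: group "product_agroup I G" by (rule P)
  have inv: "inv\<^bsub>product_agroup I G\<^esub> x = (\<lambda>i\<in>I. inv\<^bsub>G i\<^esub> x i)"
    if "x \<in> (\<Pi>\<^sub>E i\<in>I. carrier (G i))" for x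
    by (rule P.inv_equality)
      (use that grp in \<open>auto simp: PiE_iff group.l_inv group.inv_closed intro!: restrict_ext\<close>)
  show ?thesis
  proof (unfold_locales, goal_cases)
    case (1 g \<alpha>) then show ?case using G by (auto simp: PiE_iff A_group.apow_closed[where A = A])
  next
    case (2 g) then show ?case
      using G by (auto simp: PiE_iff A_group.apow_one[where A = A] intro!: extensionalityI[of _ I])
  next
    case (3 g) then show ?case
      using G by (auto simp: PiE_iff A_group.apow_zero[where A = A] intro!: extensionalityI[of _ I])
  next
    case (4 \<alpha>) then show ?case
      using G by (auto simp: PiE_iff A_group.one_apow[where A = A] intro!: extensionalityI[of _ I])
  next
    case (5 g \<alpha> \<beta>) then show ?case
      using G by (auto simp: PiE_iff A_group.apow_add[where A = A] intro!: extensionalityI[of _ I])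
  next
    case (6 g \<alpha> \<beta>) then show ?case
      using G by (auto simp: PiE_iff A_group.apow_mult[where A = A] intro!: extensionalityI[of _ I])
  next
    case (7 g h \<alpha>) then show ?case
      using G by (auto simp: inv PiE_iff A_group.apow_conj[where A = A] intro!: extensionalityI[of _ I])
  next
    case (8 g h \<alpha>)
    then have eq: "(\<lambda>i\<in>I. g i \<otimes>\<^bsub>G i\<^esub> h i) = (\<lambda>i\<in>I. h i \<otimes>\<^bsub>G i\<^esub> g i)"
      using commutator_eq_one_iff[OF P, of g h] by simp
    have "commutator (G i) (g i) (h i) = \<one>\<^bsub>G i\<^esub>" if "i \<in> I" for i
    proof -
      have "g i \<otimes>\<^bsub>G i\<^esub> h i = h i \<otimes>\<^bsub>G i\<^esub> g i"
        using fun_cong[OF eq, of i] that by simp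
      then show ?thesis
        using 8 that grp by (simp add: commutator_eq_one_iff PiE_iff)
    qed
    with 8 show ?case
      using G by (auto simp: PiE_iff A_group.apow_commute[where A = A] intro!: extensionalityI[of _ I])
  qed
qed

theorem tensor_completion_exists:
  fixes A :: "('a, 'm) ring_scheme" and G :: "('g, 'a) pagroup"
  assumes G: "partial_A_group A G"
  obtains C :: "(('g, 'a) pow_term set, 'a) agroup" and \<iota> where
    "tensor_completion TYPE(('g, 'a) pow_term set) A G C \<iota>"
proof -
  interpret G: partial_A_group A G by fact
  define T where "T = {(H :: (('g, 'a) pow_term set, 'a) agroup, \<phi>).
    A_group A H \<and> \<phi> \<in> partial_A_hom A G (as_partial H)}"
  define P where "P = product_agroup T fst"
  define d where "d = (\<lambda>g. \<lambda>p\<in>T. snd p g)"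
  have P: "A_group A P"
    unfolding P_def by (rule A_group_product) (auto simp: T_def G.A.ring_axioms)
  have closed: "x \<in> carrier G" if "g \<in> carrier G" "\<alpha> \<in> carrier A" "ppow G g \<alpha> = Some x" for g \<alpha> x
    using that by (rule G.ppow_closed)
  have d: "d \<in> partial_A_hom A G (as_partial P)"
    by (auto simp: partial_A_hom_as_partial_iff hom_def P_def d_def T_def Pi_iff PiE_iff
        intro!: restrict_ext)
  obtain C :: "(('g, 'a) pow_term set, 'a) agroup" and \<iota> e where
    C: "A_group A C" "\<iota> \<in> partial_A_hom A G (as_partial C)"
    "A_generate A C (\<iota> ` carrier G) = carrier C"
    "e \<in> A_hom A C P" "\<And>g. g \<in> carrier G \<Longrightarrow> e (\<iota> g) = d g"
    using generated_copy[OF P d G] by metis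
  have "tensor_completion TYPE(('g, 'a) pow_term set) A G C \<iota>"
  proof (rule tensor_completionI[OF C(1-3)])
    fix H :: "(('g, 'a) pow_term set, 'a) agroup" and \<phi>
    assume "A_group A H" "\<phi> \<in> partial_A_hom A G (as_partial H)"
    then have T: "(H, \<phi>) \<in> T" by (simp add: T_def)
    have mem: "x (H, \<phi>) \<in> carrier H" if "\<forall>p\<in>T. x p \<in> carrier (fst p)" for x
      using bspec[OF that T] by simp
    have "(\<lambda>x. x (H, \<phi>)) \<in> A_hom A P H"
      using T by (auto simp: A_hom_def hom_def P_def PiE_iff mem)
    then show "\<exists>\<psi> \<in> A_hom A C H. \<forall>g \<in> carrier G. \<psi> (\<iota> g) = \<phi> g"
      using C T by (intro bexI[of _ "(\<lambda>x. x (H, \<phi>)) \<circ> e"]) (auto intro: A_hom_comp simp: d_def)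
  qed
  then show ?thesis by (rule that)
qed

theorem faithful_iff_inj_on:
  fixes G :: "('g, 'a) pagroup" and C :: "('c, 'a) agroup"
  assumes G: "partial_A_group A G"
    and C: "tensor_completion TYPE(('g, 'a) pow_term set) A G C \<iota>"
  shows "faithful A G \<longleftrightarrow> inj_on \<iota> (carrier G)"
proof
  assume "faithful A G"
  then obtain D :: "(('g, 'a) pow_term set, 'a) agroup" and \<kappa> where
    D: "tensor_completion TYPE(('g, 'a) pow_term set) A G D \<kappa>" and inj: "inj_on \<kappa> (carrier G)"
    by (auto simp: faithful_def)
  obtain \<psi> where "\<And>g. g \<in> carrier G \<Longrightarrow> \<psi> (\<iota> g) = \<kappa> g"
    using tensor_completion_lift[OF C tensor_completionD(1,2)[OF D]] by metis
  with inj show "inj_on \<iota> (carrier G)" by (metis inj_on_def)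
next
  assume inj: "inj_on \<iota> (carrier G)"
  obtain D :: "(('g, 'a) pow_term set, 'a) agroup" and \<kappa> where
    D: "tensor_completion TYPE(('g, 'a) pow_term set) A G D \<kappa>"
    using tensor_completion_exists[OF G] by metis
  obtain \<psi> where "\<And>g. g \<in> carrier G \<Longrightarrow> \<psi> (\<kappa> g) = \<iota> g"
    using tensor_completion_lift[OF tensor_completion_any_type[OF G D] tensor_completionD(1,2)[OF C]]
    by metis
  with inj have "inj_on \<kappa> (carrier G)" by (metis inj_on_def)
  with D show "faithful A G" by (auto simp: faithful_def)
qed


section \<open>Direct sums and direct limits\<close>

definition direct_sum :: "'i set \<Rightarrow> ('i \<Rightarrow> ('g, 'a) pagroup) \<Rightarrow> ('i \<Rightarrow> 'g, 'a) pagroup" where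
  "direct_sum I G = \<lparr>carrier = carrier (sum_group I G), monoid.mult = monoid.mult (sum_group I G),
     one = one (sum_group I G),
     ppow = (\<lambda>x \<alpha>. if \<forall>i\<in>I. ppow (G i) (x i) \<alpha> \<noteq> None
                   then Some (\<lambda>i\<in>I. the (ppow (G i) (x i) \<alpha>)) else None)\<rparr>"

locale directed_set =
  fixes I :: "'i set" and r :: "'i \<Rightarrow> 'i \<Rightarrow> bool" (infix "\<preceq>" 50)
  assumes nonempty: "I \<noteq> {}"
    and refl: "i \<in> I \<Longrightarrow> i \<preceq> i"
    and trans: "\<lbrakk>i \<in> I; j \<in> I; k \<in> I; i \<preceq> j; j \<preceq> k\<rbrakk> \<Longrightarrow> i \<preceq> k"
    and directed: "\<lbrakk>i \<in> I; j \<in> I\<rbrakk> \<Longrightarrow> \<exists>k\<in>I. i \<preceq> k \<and> j \<preceq> k"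

locale direct_system = directed_set I r
  for A :: "('a, 'm) ring_scheme" and I :: "'i set" and r :: "'i \<Rightarrow> 'i \<Rightarrow> bool" (infix "\<preceq>" 50)
    and G :: "'i \<Rightarrow> ('g, 'a) pagroup" and f :: "'i \<Rightarrow> 'i \<Rightarrow> 'g \<Rightarrow> 'g" +
  assumes partial_A_group: "i \<in> I \<Longrightarrow> partial_A_group A (G i)"
    and transition: "\<lbrakk>i \<in> I; j \<in> I; i \<preceq> j\<rbrakk> \<Longrightarrow> f i j \<in> partial_A_hom A (G i) (G j)"
    and transition_id: "\<lbrakk>i \<in> I; x \<in> carrier (G i)\<rbrakk> \<Longrightarrow> f i i x = x"
    and transition_comp: "\<lbrakk>i \<in> I; j \<in> I; k \<in> I; i \<preceq> j; j \<preceq> k; x \<in> carrier (G i)\<rbrakk>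
      \<Longrightarrow> f j k (f i j x) = f i k x"

definition direct_limit_rel ::
  "'i set \<Rightarrow> ('i \<Rightarrow> 'i \<Rightarrow> bool) \<Rightarrow> ('i \<Rightarrow> ('g, 'a) pagroup) \<Rightarrow> ('i \<Rightarrow> 'i \<Rightarrow> 'g \<Rightarrow> 'g)
     \<Rightarrow> (('i \<times> 'g) \<times> ('i \<times> 'g)) set" where
  "direct_limit_rel I r G f = {((i, x), (j, y)) | i x j y.
     i \<in> I \<and> x \<in> carrier (G i) \<and> j \<in> I \<and> y \<in> carrier (G j) \<and>
     (\<exists>k\<in>I. r i k \<and> r j k \<and> f i k x = f j k y)}"

text \<open>The elements of the limit are the classes of \<^const>\<open>direct_limit_rel\<close>. An operation is given
  by the union of the classes obtained from all admissible representatives; for a direct system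
  these classes all coincide. To multiply, one takes representatives with a common index.\<close>

definition direct_limit ::
  "'i set \<Rightarrow> ('i \<Rightarrow> 'i \<Rightarrow> bool) \<Rightarrow> ('i \<Rightarrow> ('g, 'a) pagroup) \<Rightarrow> ('i \<Rightarrow> 'i \<Rightarrow> 'g \<Rightarrow> 'g)
     \<Rightarrow> (('i \<times> 'g) set, 'a) pagroup" where
  "direct_limit I r G f =
     (let cls = (\<lambda>p. direct_limit_rel I r G f `` {p}) in
      \<lparr>carrier = (SIGMA i:I. carrier (G i)) // direct_limit_rel I r G f,
       monoid.mult = (\<lambda>U V. \<Union> {cls (k, x \<otimes>\<^bsub>G k\<^esub> y) | k x y. (k, x) \<in> U \<and> (k, y) \<in> V}),
       one = (\<Union>i\<in>I. cls (i, \<one>\<^bsub>G i\<^esub>)),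
       ppow = (\<lambda>U \<alpha>. if \<exists>i x. (i, x) \<in> U \<and> ppow (G i) x \<alpha> \<noteq> None
                     then Some (\<Union> {cls (i, z) | i x z. (i, x) \<in> U \<and> ppow (G i) x \<alpha> = Some z})
                     else None)\<rparr>)"

end

theory Submission
  imports Defs
begin

text \<open>A partial \<open>A\<close>-group is faithful as soon as it embeds, by a partial \<open>A\<close>-homomorphism, into some
  \<open>A\<close>-group, because such an embedding factors through the completion. A direct sum embeds into the
  product of the completions of its summands. The transition maps of a direct system extend to the
  completions, and the limit of the system embeds into the limit of the completions: an equality
  between images of elements of the system already holds in the completion at some index, where the
  canonical map is injective.\<close>

section \<open>A criterion for faithfulness\<close>

lemma faithfulI:
  fixes G :: "('g, 'a) pagroup" and H :: "('h, 'a) agroup"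
  assumes G: "partial_A_group A G" and H: "A_group A H"
    and \<phi>: "\<phi> \<in> partial_A_hom A G (as_partial H)" and inj: "inj_on \<phi> (carrier G)"
  shows "faithful A G"
proof -
  obtain D :: "(('g, 'a) pow_term set, 'a) agroup" and \<kappa> where
    D: "tensor_completion TYPE(('g, 'a) pow_term set) A G D \<kappa>"
    using tensor_completion_exists[OF G] by metis
  \<comment> \<open>\<open>H\<close> has an arbitrary element type, whereas the universal property
    of \<open>D\<close> is given only for groups of sets of terms;
    \<open>tensor_completion_any_type\<close> removes this restriction.\<close>
  obtain \<psi> where "\<And>g. g \<in> carrier G \<Longrightarrow> \<psi> (\<kappa> g) = \<phi> g"
    using tensor_completion_lift[OF tensor_completion_any_type[OF G D] H \<phi>] by metis
  with inj have "inj_on \<kappa> (carrier G)" by (metis inj_on_def)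
  with D show ?thesis by (auto simp: faithful_def)
qed

section \<open>Passage between A-groups and partial A-groups\<close>

lemma partial_A_hom_ppow:
  assumes "f \<in> partial_A_hom A G H" "g \<in> carrier G" "\<alpha> \<in> carrier A" "ppow G g \<alpha> = Some x"
  shows "ppow H (f g) \<alpha> = Some (f x)"
  using assms by (auto simp: partial_A_hom_def)

lemma partial_A_hom_hom: "f \<in> partial_A_hom A G H \<Longrightarrow> f \<in> hom G H"
  by (simp add: partial_A_hom_def)

lemma group_as_partial: "group G \<Longrightarrow> group (as_partial G)"
  unfolding group_def monoid_def group_axioms_def Units_def by simp

lemma inv_as_partial: "inv\<^bsub>as_partial G\<^esub> x = inv\<^bsub>G\<^esub> x"
  by (simp add: m_inv_def)

lemma commutator_as_partial: "commutator (as_partial G) g h = commutator G g h"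
  by (simp add: commutator_def inv_as_partial)

text \<open>Lets a system of A-groups be treated as an instance of \<open>direct_system\<close>, so
  that the construction of limits is carried out only once, for partial A-groups.\<close>

lemma partial_A_group_as_partial:
  assumes "A_group A G"
  shows "partial_A_group A (as_partial G)"
proof -
  interpret A_group A G by fact
  interpret P: group "as_partial G" by (rule group_as_partial) (rule G.group_axioms)
  show ?thesis
    by unfold_locales
      (auto simp: inv_as_partial commutator_as_partial apow_closed apow_one apow_zero one_apow
        apow_add apow_mult apow_conj apow_commute)
qed

lemma A_hom_imp_partial_A_hom: "f \<in> A_hom A G H \<Longrightarrow> f \<in> partial_A_hom A (as_partial G) (as_partial H)"
  by (auto simp: A_hom_def partial_A_hom_def hom_def)

text \<open>Converse of \<open>as_partial\<close>, meant for a partial action that is defined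
  everywhere; elsewhere \<open>the\<close> yields no specified value. It turns a limit formed among
  partial A-groups back into an A-group.\<close>

definition as_total :: "('g, 'a) pagroup \<Rightarrow> ('g, 'a) agroup" where
  "as_total G = \<lparr>carrier = carrier G, monoid.mult = monoid.mult G, one = one G,
     apow = (\<lambda>g \<alpha>. the (ppow G g \<alpha>))\<rparr>"

lemma as_total_simps [simp]:
  "carrier (as_total G) = carrier G" "monoid.mult (as_total G) = monoid.mult G"
  "one (as_total G) = one G" "apow (as_total G) = (\<lambda>g \<alpha>. the (ppow G g \<alpha>))"
  by (simp_all add: as_total_def)

lemma A_group_as_total:
  assumes "partial_A_group A G"
    and total: "\<And>g \<alpha>. g \<in> carrier G \<Longrightarrow> \<alpha> \<in> carrier A \<Longrightarrow> ppow G g \<alpha> \<noteq> None"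
  shows "A_group A (as_total G)"
proof -
  interpret partial_A_group A G by fact
  interpret T: group "as_total G"
    using G.group_axioms unfolding group_def monoid_def group_axioms_def Units_def by simp
  have inv: "inv\<^bsub>as_total G\<^esub> x = inv\<^bsub>G\<^esub> x" for x
    by (simp add: m_inv_def)
  have pow: "ppow G g \<alpha> = Some (the (ppow G g \<alpha>))" if "g \<in> carrier G" "\<alpha> \<in> carrier A" for g \<alpha>
    using total[OF that] by simp
  have closed: "the (ppow G g \<alpha>) \<in> carrier G" if "g \<in> carrier G" "\<alpha> \<in> carrier A" for g \<alpha>
    using that pow[OF that] by (rule ppow_closed)
  show ?thesis
  proof (unfold_locales, goal_cases)
    case (5 g \<alpha> \<beta>) then show ?case
      using ppow_add[of g \<alpha> \<beta>, OF _ _ _ pow pow] by simp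
  next
    case (6 g \<alpha> \<beta>) then show ?case
      using ppow_mult[of g \<alpha> \<beta>, OF _ _ _ pow pow] closed by simp
  next
    case (7 g h \<alpha>) then show ?case
      using ppow_conj[of g h \<alpha>, OF _ _ _ pow] by (simp add: inv)
  next
    case (8 g h \<alpha>) then show ?case
      using ppow_commute[of g h \<alpha>, OF _ _ _ _ pow pow] by (simp add: inv commutator_def)
  qed (simp_all add: closed ppow_one ppow_zero one_ppow)
qed

section \<open>Direct sums\<close>

lemma direct_sum_simps:
  "monoid.mult (direct_sum I G) = (\<lambda>x y. \<lambda>i\<in>I. x i \<otimes>\<^bsub>G i\<^esub> y i)"
  "one (direct_sum I G) = (\<lambda>i\<in>I. \<one>\<^bsub>G i\<^esub>)"
  by (simp_all add: direct_sum_def)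

lemma carrier_direct_sum:
  assumes "\<And>i. i \<in> I \<Longrightarrow> group (G i)"
  shows "carrier (direct_sum I G) =
    {x \<in> \<Pi>\<^sub>E i\<in>I. carrier (G i). finite {i \<in> I. x i \<noteq> \<one>\<^bsub>G i\<^esub>}}"
  using carrier_sum_group[of I G] assms by (simp add: direct_sum_def)

text \<open>Replaces the \<open>if\<close> and \<open>the\<close> of the definition by one equation
  per coordinate, so that the axioms for the sum split into the axioms for the summands.
  Extensionality makes these equations determine \<open>y\<close>.\<close>

lemma ppow_direct_sum_eq_Some:
  "ppow (direct_sum I G) x \<alpha> = Some y \<longleftrightarrow>
     y \<in> extensional I \<and> (\<forall>i\<in>I. ppow (G i) (x i) \<alpha> = Some (y i))"
  by (auto simp: direct_sum_def intro!: extensionalityI[of _ I]) force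

lemma ppow_direct_sum_eq_None:
  "ppow (direct_sum I G) x \<alpha> = None \<longleftrightarrow> (\<exists>i\<in>I. ppow (G i) (x i) \<alpha> = None)"
  by (auto simp: direct_sum_def)

lemma group_direct_sum:
  assumes "\<And>i. i \<in> I \<Longrightarrow> group (G i)"
  shows "group (direct_sum I G)"
proof -
  \<comment> \<open>The group axioms involve only carrier, product and unit, on which
    \<open>direct_sum\<close> and \<open>sum_group\<close> agree.\<close>
  have "group (sum_group I G)" using assms by simp
  then show ?thesis
    unfolding group_def monoid_def group_axioms_def Units_def direct_sum_def by simp
qed

lemma inv_direct_sum:
  assumes grp: "\<And>i. i \<in> I \<Longrightarrow> group (G i)" and x: "x \<in> carrier (direct_sum I G)"
  shows "inv\<^bsub>direct_sum I G\<^esub> x = (\<lambda>i\<in>I. inv\<^bsub>G i\<^esub> x i)"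
proof -
  interpret group "direct_sum I G" by (rule group_direct_sum[OF grp])
  show ?thesis
  proof (rule inv_equality[OF _ x])
    show "(\<lambda>i\<in>I. inv\<^bsub>G i\<^esub> x i) \<otimes>\<^bsub>direct_sum I G\<^esub> x = \<one>\<^bsub>direct_sum I G\<^esub>"
      using x by (auto simp: direct_sum_simps carrier_direct_sum grp PiE_iff group.l_inv intro!: restrict_ext)
    \<comment> \<open>Inversion leaves the support unchanged, so the coordinatewise inverse again
      has finite support.\<close>
    have "inv\<^bsub>G i\<^esub> x i = \<one>\<^bsub>G i\<^esub> \<longleftrightarrow> x i = \<one>\<^bsub>G i\<^esub>" if "i \<in> I" for i
      using x that grp by (auto simp: carrier_direct_sum PiE_iff group.inv_eq_1_iff)
    then have "{i \<in> I. (\<lambda>i\<in>I. inv\<^bsub>G i\<^esub> x i) i \<noteq> \<one>\<^bsub>G i\<^esub>} = {i \<in> I. x i \<noteq> \<one>\<^bsub>G i\<^esub>}"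
      by auto
    then show "(\<lambda>i\<in>I. inv\<^bsub>G i\<^esub> x i) \<in> carrier (direct_sum I G)"
      using x grp by (auto simp: carrier_direct_sum PiE_iff group.inv_closed)
  qed
qed

lemma partial_A_group_direct_sum:
  assumes A: "ring A" and G: "\<And>i. i \<in> I \<Longrightarrow> partial_A_group A (G i)"
  shows "partial_A_group A (direct_sum I G)"
proof -
  have grp: "group (G i)" if "i \<in> I" for i
    using G[OF that] by (simp add: partial_A_group_def)
  interpret A: ring A by fact
  interpret S: group "direct_sum I G" by (rule group_direct_sum[OF grp])
  note S = direct_sum_simps ppow_direct_sum_eq_Some carrier_direct_sum[OF grp] PiE_iff
  have mem: "x i \<in> carrier (G i)" if "x \<in> carrier (direct_sum I G)" "i \<in> I" for x i
    using that by (auto simp: S)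
  have ext: "x \<in> extensional I" if "x \<in> carrier (direct_sum I G)" for x
    using that by (auto simp: S)
  show ?thesis
  proof (unfold_locales, goal_cases)
    case (1 g \<alpha> x)
    \<comment> \<open>Powers of the unit are the unit, so taking a power cannot enlarge the support;
      this keeps it finite.\<close>
    have "x i = \<one>\<^bsub>G i\<^esub>" if "i \<in> I" "g i = \<one>\<^bsub>G i\<^esub>" for i
      using 1 that partial_A_group.one_ppow[OF G, of i \<alpha>] by (auto simp: S)
    then have "{i \<in> I. x i \<noteq> \<one>\<^bsub>G i\<^esub>} \<subseteq> {i \<in> I. g i \<noteq> \<one>\<^bsub>G i\<^esub>}"
      by auto
    moreover have "finite {i \<in> I. g i \<noteq> \<one>\<^bsub>G i\<^esub>}" using 1 by (simp add: S)
    moreover have "x i \<in> carrier (G i)" if "i \<in> I" for i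
      using 1 that partial_A_group.ppow_closed[OF G, of i "g i" \<alpha> "x i"] by (auto simp: S)
    ultimately show ?case using 1 by (auto simp: S intro: finite_subset)
  next
    case (2 g) then show ?case
      by (simp add: ppow_direct_sum_eq_Some ext mem partial_A_group.ppow_one[OF G])
  next
    case (3 g) then show ?case
      by (simp add: ppow_direct_sum_eq_Some direct_sum_simps mem partial_A_group.ppow_zero[OF G])
  next
    case (4 \<alpha>) then show ?case
      by (simp add: ppow_direct_sum_eq_Some direct_sum_simps partial_A_group.one_ppow[OF G])
  next
    case (5 g \<alpha> \<beta> x y) then show ?case
      by (simp add: ppow_direct_sum_eq_Some direct_sum_simps mem partial_A_group.ppow_add[OF G])
  next
    case (6 g \<alpha> \<beta> x y) then show ?case
      unfolding ppow_direct_sum_eq_Some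
      by (auto intro: partial_A_group.ppow_mult[OF G] mem)
  next
    case (7 g h \<alpha> x) then show ?case
      by (simp add: ppow_direct_sum_eq_Some direct_sum_simps inv_direct_sum[OF grp] mem
          partial_A_group.ppow_conj[OF G])
  next
    case (8 g h \<alpha>)
    \<comment> \<open>A power in the sum is defined exactly if it is defined in every coordinate, so
      definedness can be pulled back from the conjugate one coordinate at a time.\<close>
    have "ppow (G i) (g i) \<alpha> \<noteq> None" if "i \<in> I" for i
      using partial_A_group.ppow_conj_defined[OF G, of i "g i" "h i" \<alpha>] 8 that
      by (auto simp: ppow_direct_sum_eq_None direct_sum_simps inv_direct_sum[OF grp] mem)
    then show ?case by (simp add: ppow_direct_sum_eq_None)
  next
    case (9 g h \<alpha> x y)
    \<comment> \<open>Commuting in the sum is an equality of restricted functions; its value at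
      \<open>i\<close> says that the coordinates commute.\<close>
    then have eq: "(\<lambda>i\<in>I. g i \<otimes>\<^bsub>G i\<^esub> h i) = (\<lambda>i\<in>I. h i \<otimes>\<^bsub>G i\<^esub> g i)"
      using commutator_eq_one_iff[OF S.group_axioms, of g h] by (simp add: direct_sum_simps)
    have "commutator (G i) (g i) (h i) = \<one>\<^bsub>G i\<^esub>" if "i \<in> I" for i
      using fun_cong[OF eq, of i] that 9 by (simp add: commutator_eq_one_iff grp mem)
    with 9 show ?case
      by (simp add: ppow_direct_sum_eq_Some direct_sum_simps mem partial_A_group.ppow_commute[OF G])
  qed
qed

section \<open>Embedding the direct sum into a product of completions\<close>

theorem faithful_direct_sum:
  fixes A :: "('a, 'm) ring_scheme" and G :: "'i \<Rightarrow> ('g, 'a) pagroup"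
  assumes A: "ring A" and G: "\<And>i. i \<in> I \<Longrightarrow> G i \<in> faithful_partial_A_groups A"
  shows "direct_sum I G \<in> faithful_partial_A_groups A"
proof -
  have pG: "partial_A_group A (G i)" if "i \<in> I" for i
    using G[OF that] by (simp add: faithful_partial_A_groups_def)
  have grp: "group (G i)" if "i \<in> I" for i
    using pG[OF that] by (simp add: partial_A_group_def)
  \<comment> \<open>A completion and its canonical map are chosen together, as a pair, because the
    type of each choice must not depend on the index.\<close>
  have "\<forall>i\<in>I. \<exists>p :: (('g, 'a) pow_term set, 'a) agroup \<times> ('g \<Rightarrow> ('g, 'a) pow_term set).
      A_group A (fst p) \<and> snd p \<in> partial_A_hom A (G i) (as_partial (fst p)) \<and>
      inj_on (snd p) (carrier (G i))"
    using G unfolding faithful_partial_A_groups_def faithful_def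
    by (fastforce dest: tensor_completionD(1,2))
  then obtain p :: "'i \<Rightarrow> (('g, 'a) pow_term set, 'a) agroup \<times> ('g \<Rightarrow> ('g, 'a) pow_term set)" where
    p: "\<And>i. i \<in> I \<Longrightarrow> A_group A (fst (p i)) \<and>
      snd (p i) \<in> partial_A_hom A (G i) (as_partial (fst (p i))) \<and> inj_on (snd (p i)) (carrier (G i))"
    by metis
  define P where "P = product_agroup I (fst \<circ> p)"
  define d where "d = (\<lambda>x. \<lambda>i\<in>I. snd (p i) (x i))"
  have S: "partial_A_group A (direct_sum I G)"
    by (rule partial_A_group_direct_sum[OF A pG])
  have P: "A_group A P"
    unfolding P_def by (rule A_group_product[OF A]) (simp add: p)
  have sub: "x i \<in> carrier (G i)" if "x \<in> carrier (direct_sum I G)" "i \<in> I" for x i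
    using that by (auto simp: carrier_direct_sum[OF grp])
  have "d \<in> hom (direct_sum I G) P"
    using p by (auto simp: hom_def d_def P_def direct_sum_simps partial_A_hom_as_partial_iff Pi_iff
        PiE_iff sub intro!: restrict_ext)
  moreover have "d x = apow P (d g) \<alpha>"
    \<comment> \<open>A power defined in the sum is defined in each coordinate, where the canonical
      map preserves it.\<close>
    if "g \<in> carrier (direct_sum I G)" "\<alpha> \<in> carrier A" "ppow (direct_sum I G) g \<alpha> = Some x" for g \<alpha> x
  proof -
    have "snd (p i) (x i) = apow (fst (p i)) (snd (p i) (g i)) \<alpha>" if "i \<in> I" for i
      using p[OF that] \<open>i \<in> I\<close> \<open>g \<in> _\<close> \<open>\<alpha> \<in> _\<close> \<open>ppow _ _ _ = _\<close>
      by (simp add: ppow_direct_sum_eq_Some partial_A_hom_as_partial_iff sub)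
    then show ?thesis
      by (simp add: d_def P_def cong: restrict_cong)
  qed
  ultimately have d: "d \<in> partial_A_hom A (direct_sum I G) (as_partial P)"
    by (simp add: partial_A_hom_as_partial_iff)
  have "inj_on d (carrier (direct_sum I G))"
  proof (rule inj_onI)
    fix x y assume xy: "x \<in> carrier (direct_sum I G)" "y \<in> carrier (direct_sum I G)" and eq: "d x = d y"
    have "x i = y i" if "i \<in> I" for i
      using fun_cong[OF eq, of i] p[OF that] xy that by (auto simp: d_def sub dest: inj_onD)
    with xy show "x = y"
      by (auto simp: carrier_direct_sum[OF grp] intro: PiE_ext)
  qed
  with S show ?thesis
    by (simp add: faithful_partial_A_groups_def faithfulI[OF S P d])
qed

section \<open>Direct limits\<close>

context direct_system
begin

abbreviation "colim \<equiv> direct_limit I r G f"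

text \<open>Curried form of the local \<open>cls\<close> in \<open>direct_limit\<close>; folding it
  after unfolding \<open>direct_limit_def\<close> brings the operations of the limit into terms of
  classes.\<close>

definition cls :: "'i \<Rightarrow> 'g \<Rightarrow> ('i \<times> 'g) set" where
  "cls i x = direct_limit_rel I r G f `` {(i, x)}"

lemma group_G: "i \<in> I \<Longrightarrow> group (G i)"
  using partial_A_group by (simp add: partial_A_group_def)

lemma mult_closed: "\<lbrakk>i \<in> I; x \<in> carrier (G i); y \<in> carrier (G i)\<rbrakk> \<Longrightarrow> x \<otimes>\<^bsub>G i\<^esub> y \<in> carrier (G i)"
  using group_G by (blast intro: monoid.m_closed group.is_monoid)

lemma inv_closed: "\<lbrakk>i \<in> I; x \<in> carrier (G i)\<rbrakk> \<Longrightarrow> inv\<^bsub>G i\<^esub> x \<in> carrier (G i)"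
  using group_G by (blast intro: group.inv_closed)

lemma one_closed: "i \<in> I \<Longrightarrow> \<one>\<^bsub>G i\<^esub> \<in> carrier (G i)"
  using group_G by (blast intro: monoid.one_closed group.is_monoid)

lemma transition_group_hom: "i \<in> I \<Longrightarrow> j \<in> I \<Longrightarrow> i \<preceq> j \<Longrightarrow> group_hom (G i) (G j) (f i j)"
  by (simp add: group_hom.intro group_hom_axioms.intro group_G partial_A_hom_hom[OF transition])

lemma transition_closed:
  "\<lbrakk>i \<in> I; j \<in> I; i \<preceq> j; x \<in> carrier (G i)\<rbrakk> \<Longrightarrow> f i j x \<in> carrier (G j)"
  by (rule group_hom.hom_closed[OF transition_group_hom])

lemma transition_ppow:
  "\<lbrakk>i \<in> I; j \<in> I; i \<preceq> j; x \<in> carrier (G i); \<alpha> \<in> carrier A; ppow (G i) x \<alpha> = Some z\<rbrakk>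
    \<Longrightarrow> ppow (G j) (f i j x) \<alpha> = Some (f i j z)"
  by (rule partial_A_hom_ppow[OF transition])

lemma equiv_direct_limit_rel: "equiv (SIGMA i:I. carrier (G i)) (direct_limit_rel I r G f)"
proof (rule equivI)
  show "direct_limit_rel I r G f \<subseteq> (SIGMA i:I. carrier (G i)) \<times> (SIGMA i:I. carrier (G i))"
    by (auto simp: direct_limit_rel_def)
  show "refl_on (SIGMA i:I. carrier (G i)) (direct_limit_rel I r G f)"
    using refl by (fastforce simp: direct_limit_rel_def refl_on_def)
  show "sym (direct_limit_rel I r G f)"
    by (rule symI) (auto simp: direct_limit_rel_def, metis)
  show "trans (direct_limit_rel I r G f)"
  proof (rule transI)
    fix p q s
    assume "(p, q) \<in> direct_limit_rel I r G f" "(q, s) \<in> direct_limit_rel I r G f"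
    then obtain i x j y l z k m where
      *: "p = (i, x)" "q = (j, y)" "s = (l, z)" "i \<in> I" "j \<in> I" "l \<in> I" "k \<in> I" "m \<in> I"
      "x \<in> carrier (G i)" "y \<in> carrier (G j)" "z \<in> carrier (G l)"
      "i \<preceq> k" "j \<preceq> k" "j \<preceq> m" "l \<preceq> m" "f i k x = f j k y" "f j m y = f l m z"
      unfolding direct_limit_rel_def by auto
    \<comment> \<open>The two equalities hold at \<open>k\<close> and at \<open>m\<close>; at an
      index above both they can be chained through the image of \<open>y\<close>.\<close>
    obtain n where n: "n \<in> I" "k \<preceq> n" "m \<preceq> n"
      using directed * by metis
    have "f i n x = f l n z"
      using * n by (metis transition_comp)
    then show "(p, s) \<in> direct_limit_rel I r G f"
      using * n trans unfolding direct_limit_rel_def by blast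
  qed
qed

lemma cls_eq_iff:
  assumes "i \<in> I" "x \<in> carrier (G i)" "j \<in> I" "y \<in> carrier (G j)"
  shows "cls i x = cls j y \<longleftrightarrow> (\<exists>k\<in>I. i \<preceq> k \<and> j \<preceq> k \<and> f i k x = f j k y)"
  using eq_equiv_class_iff[OF equiv_direct_limit_rel, of "(i, x)" "(j, y)"] assms
  unfolding cls_def by (auto simp: direct_limit_rel_def)

text \<open>The operations of the limit quantify over members of classes; this turns membership into
  an equality of classes, to which \<open>cls_eq_transition\<close> applies.\<close>

lemma mem_cls_iff:
  assumes "i \<in> I" "x \<in> carrier (G i)"
  shows "(j, y) \<in> cls i x \<longleftrightarrow> j \<in> I \<and> y \<in> carrier (G j) \<and> cls j y = cls i x"
proof
  assume "(j, y) \<in> cls i x"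
  then have rel: "((i, x), (j, y)) \<in> direct_limit_rel I r G f"
    by (simp add: cls_def)
  then have "cls i x = cls j y"
    unfolding cls_def by (rule equiv_class_eq[OF equiv_direct_limit_rel])
  with rel show "j \<in> I \<and> y \<in> carrier (G j) \<and> cls j y = cls i x"
    by (auto simp: direct_limit_rel_def)
next
  assume "j \<in> I \<and> y \<in> carrier (G j) \<and> cls j y = cls i x"
  then show "(j, y) \<in> cls i x"
    using equiv_class_self[OF equiv_direct_limit_rel, of "(j, y)"] unfolding cls_def by auto
qed

text \<open>The two elements already agree at index \<open>k\<close>, because \<open>f k k\<close>
  is the identity on the carrier of \<open>G k\<close>.\<close>

lemma cls_transition:
  assumes "i \<in> I" "k \<in> I" "i \<preceq> k" "x \<in> carrier (G i)"
  shows "cls k (f i k x) = cls i x"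
  using assms by (subst cls_eq_iff) (auto simp: transition_closed transition_id intro: refl)

lemma carrier_colim: "carrier colim = {cls i x | i x. i \<in> I \<and> x \<in> carrier (G i)}"
  by (auto simp: direct_limit_def quotient_def cls_def Let_def)

lemma cls_in_colim: "i \<in> I \<Longrightarrow> x \<in> carrier (G i) \<Longrightarrow> cls i x \<in> carrier colim"
  by (auto simp: carrier_colim)

lemma colim_cases:
  assumes "U \<in> carrier colim"
  obtains i x where "i \<in> I" "x \<in> carrier (G i)" "U = cls i x"
  using assms by (auto simp: carrier_colim)

text \<open>Directedness gives an index above those of the two representatives, so that both
  elements can be handled inside a single group.\<close>

lemma colim_cases2:
  assumes "U \<in> carrier colim" "V \<in> carrier colim"
  obtains k x y where "k \<in> I" "x \<in> carrier (G k)" "y \<in> carrier (G k)" "U = cls k x" "V = cls k y"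
proof -
  obtain i x j y where *: "i \<in> I" "x \<in> carrier (G i)" "U = cls i x"
    "j \<in> I" "y \<in> carrier (G j)" "V = cls j y"
    using assms by (metis colim_cases)
  obtain k where k: "k \<in> I" "i \<preceq> k" "j \<preceq> k"
    using directed * by metis
  show ?thesis
    by (rule that[OF k(1), of "f i k x" "f j k y"]) (use * k in \<open>auto simp: transition_closed cls_transition\<close>)
qed

lemma colim_cases3:
  assumes "U \<in> carrier colim" "V \<in> carrier colim" "W \<in> carrier colim"
  obtains k x y z where "k \<in> I" "x \<in> carrier (G k)" "y \<in> carrier (G k)" "z \<in> carrier (G k)"
    "U = cls k x" "V = cls k y" "W = cls k z"
proof -
  obtain i x y where *: "i \<in> I" "x \<in> carrier (G i)" "y \<in> carrier (G i)" "U = cls i x" "V = cls i y"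
    using assms by (metis colim_cases2)
  obtain j z where **: "j \<in> I" "z \<in> carrier (G j)" "W = cls j z"
    using assms by (metis colim_cases)
  obtain k where k: "k \<in> I" "i \<preceq> k" "j \<preceq> k"
    using directed * ** by metis
  show ?thesis
    by (rule that[OF k(1), of "f i k x" "f i k y" "f j k z"])
      (use * ** k in \<open>auto simp: transition_closed cls_transition\<close>)
qed

lemma cls_eq_transition:
  assumes "i \<in> I" "x \<in> carrier (G i)" "j \<in> I" "y \<in> carrier (G j)" "cls i x = cls j y"
  obtains k where "k \<in> I" "i \<preceq> k" "j \<preceq> k" "f i k x = f j k y"
  using assms by (auto simp: cls_eq_iff)

section \<open>The group structure of the limit\<close>

lemma colim_mult:
  assumes "k \<in> I" "x \<in> carrier (G k)" "y \<in> carrier (G k)"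
  shows "cls k x \<otimes>\<^bsub>colim\<^esub> cls k y = cls k (x \<otimes>\<^bsub>G k\<^esub> y)"
proof -
  \<comment> \<open>All pairs of representatives with a common index give the same class, so the
    union in the definition of the product collapses to one class.\<close>
  have "cls l (u \<otimes>\<^bsub>G l\<^esub> v) = cls k (x \<otimes>\<^bsub>G k\<^esub> y)" if "(l, u) \<in> cls k x" "(l, v) \<in> cls k y" for l u v
  proof -
    have l: "l \<in> I" "u \<in> carrier (G l)" "v \<in> carrier (G l)" "cls l u = cls k x" "cls l v = cls k y"
      using that assms by (auto simp: mem_cls_iff)
    \<comment> \<open>At \<open>m\<close> the elements \<open>u\<close> and \<open>x\<close> become
      equal, at \<open>n\<close> the elements \<open>v\<close> and \<open>y\<close>; at
      \<open>s\<close> both equalities hold and the products agree.\<close>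
    obtain m where m: "m \<in> I" "l \<preceq> m" "k \<preceq> m" "f l m u = f k m x"
      using l assms by (metis cls_eq_transition)
    obtain n where n: "n \<in> I" "l \<preceq> n" "k \<preceq> n" "f l n v = f k n y"
      using l assms by (metis cls_eq_transition)
    obtain s where s: "s \<in> I" "m \<preceq> s" "n \<preceq> s"
      using directed m n by metis
    have ls: "l \<preceq> s" "k \<preceq> s"
      using trans l m n s assms by blast+
    have uv: "f l s u = f k s x" "f l s v = f k s y"
      using l m n s assms by (metis transition_comp)+
    have "cls l (u \<otimes>\<^bsub>G l\<^esub> v) = cls s (f l s (u \<otimes>\<^bsub>G l\<^esub> v))"
      using l s ls by (simp add: cls_transition mult_closed)
    also have "f l s (u \<otimes>\<^bsub>G l\<^esub> v) = f k s (x \<otimes>\<^bsub>G k\<^esub> y)"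
      using l s ls assms uv by (simp add: group_hom.hom_mult[OF transition_group_hom])
    also have "cls s \<dots> = cls k (x \<otimes>\<^bsub>G k\<^esub> y)"
      using s ls assms by (simp add: cls_transition mult_closed)
    finally show ?thesis .
  qed
  moreover have "(k, x) \<in> cls k x" "(k, y) \<in> cls k y"
    using assms by (simp_all add: mem_cls_iff)
  ultimately have "{cls l (u \<otimes>\<^bsub>G l\<^esub> v) | l u v. (l, u) \<in> cls k x \<and> (l, v) \<in> cls k y} =
      {cls k (x \<otimes>\<^bsub>G k\<^esub> y)}"
    by blast
  then show ?thesis
    by (simp add: direct_limit_def Let_def flip: cls_def)
qed

text \<open>Transition maps send units to units, so the units at all indices form one class, and the
  unit may be read at whichever index the other representatives have.\<close>

lemma colim_one:
  assumes "k \<in> I" shows "\<one>\<^bsub>colim\<^esub> = cls k \<one>\<^bsub>G k\<^esub>"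
proof -
  have "cls i \<one>\<^bsub>G i\<^esub> = cls k \<one>\<^bsub>G k\<^esub>" if "i \<in> I" for i
  proof -
    obtain l where l: "l \<in> I" "i \<preceq> l" "k \<preceq> l"
      using directed[OF \<open>i \<in> I\<close> assms] by auto
    have "cls l (f i l \<one>\<^bsub>G i\<^esub>) = cls l (f k l \<one>\<^bsub>G k\<^esub>)"
      using l that assms by (simp add: group_hom.hom_one[OF transition_group_hom])
    then show ?thesis
      using l that assms by (simp add: cls_transition one_closed)
  qed
  then have "(\<Union>i\<in>I. cls i \<one>\<^bsub>G i\<^esub>) = cls k \<one>\<^bsub>G k\<^esub>"
    using assms by blast
  then show ?thesis
    by (simp add: direct_limit_def Let_def flip: cls_def)
qed

lemma group_colim: "group colim"
proof (rule groupI)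
  fix U V assume "U \<in> carrier colim" "V \<in> carrier colim"
  then show "U \<otimes>\<^bsub>colim\<^esub> V \<in> carrier colim"
    by (metis colim_cases2 colim_mult cls_in_colim group_G group.is_monoid monoid.m_closed)
next
  \<comment> \<open>Nonemptiness of the index set supplies an index at which to read the
    unit.\<close>
  show "\<one>\<^bsub>colim\<^esub> \<in> carrier colim"
    using nonempty by (metis colim_one cls_in_colim ex_in_conv group_G group.is_monoid monoid.one_closed)
next
  fix U V W assume "U \<in> carrier colim" "V \<in> carrier colim" "W \<in> carrier colim"
  then obtain k x y z where k: "k \<in> I" "x \<in> carrier (G k)" "y \<in> carrier (G k)"
    "z \<in> carrier (G k)" "U = cls k x" "V = cls k y" "W = cls k z"
    by (rule colim_cases3)
  interpret group "G k" by (rule group_G[OF k(1)])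
  show "U \<otimes>\<^bsub>colim\<^esub> V \<otimes>\<^bsub>colim\<^esub> W = U \<otimes>\<^bsub>colim\<^esub> (V \<otimes>\<^bsub>colim\<^esub> W)"
    using k by (simp add: colim_mult m_assoc)
next
  fix U assume "U \<in> carrier colim"
  then obtain k x where k: "k \<in> I" "x \<in> carrier (G k)" "U = cls k x"
    by (rule colim_cases)
  then interpret group "G k" by (intro group_G)
  show "\<one>\<^bsub>colim\<^esub> \<otimes>\<^bsub>colim\<^esub> U = U"
    using k by (simp add: colim_one[OF k(1)] colim_mult)
  show "\<exists>V\<in>carrier colim. V \<otimes>\<^bsub>colim\<^esub> U = \<one>\<^bsub>colim\<^esub>"
    using k by (intro bexI[of _ "cls k (inv\<^bsub>G k\<^esub> x)"]) (simp_all add: colim_one[OF k(1)] colim_mult cls_in_colim)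
qed

lemma colim_inv:
  assumes "k \<in> I" "x \<in> carrier (G k)"
  shows "inv\<^bsub>colim\<^esub> cls k x = cls k (inv\<^bsub>G k\<^esub> x)"
proof -
  interpret group "G k" by (rule group_G[OF assms(1)])
  show ?thesis
    by (rule group.inv_equality[OF group_colim])
      (use assms in \<open>auto simp: colim_one[OF assms(1)] colim_mult cls_in_colim\<close>)
qed

section \<open>The partial action on the limit\<close>

lemma colim_ppow:
  assumes k: "k \<in> I" "x \<in> carrier (G k)" and \<alpha>: "\<alpha> \<in> carrier A" and z: "ppow (G k) x \<alpha> = Some z"
  shows "ppow colim (cls k x) \<alpha> = Some (cls k z)"
proof -
  have closed: "w \<in> carrier (G i)" if "i \<in> I" "u \<in> carrier (G i)" "ppow (G i) u \<alpha> = Some w" for i u w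
    by (rule partial_A_group.ppow_closed[OF partial_A_group]) (use that \<alpha> in auto)
  \<comment> \<open>Independence of the representative: at \<open>m\<close> the elements
    \<open>u\<close> and \<open>x\<close> become equal, and since transition maps preserve defined
    powers, the images of \<open>w\<close> and \<open>z\<close> are powers of the same
    element.\<close>
  have "cls i w = cls k z" if "(i, u) \<in> cls k x" and w: "ppow (G i) u \<alpha> = Some w" for i u w
  proof -
    have i: "i \<in> I" "u \<in> carrier (G i)" "cls i u = cls k x"
      using that k by (auto simp: mem_cls_iff)
    obtain m where m: "m \<in> I" "i \<preceq> m" "k \<preceq> m" "f i m u = f k m x"
      using i k by (metis cls_eq_transition)
    have "Some (f i m w) = Some (f k m z)"
      using transition_ppow[of i m u \<alpha> w] transition_ppow[of k m x \<alpha> z] i k m w z \<alpha> by simp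
    then show ?thesis
      using i k m w z by (metis closed cls_transition option.inject)
  qed
  moreover have mem: "(k, x) \<in> cls k x"
    using k by (simp add: mem_cls_iff)
  ultimately have "{cls i w | i u w. (i, u) \<in> cls k x \<and> ppow (G i) u \<alpha> = Some w} = {cls k z}"
    using z by blast
  moreover have "\<exists>i u. (i, u) \<in> cls k x \<and> ppow (G i) u \<alpha> \<noteq> None"
    using mem z by blast
  ultimately show ?thesis
    by (simp add: direct_limit_def Let_def flip: cls_def)
qed

text \<open>Converse of \<open>colim_ppow\<close>. The representative is obtained rather than given,
  since other representatives of \<open>U\<close> may have no such power.\<close>

lemma colim_ppow_cases:
  assumes U: "U \<in> carrier colim" and \<alpha>: "\<alpha> \<in> carrier A" and V: "ppow colim U \<alpha> = Some V"
  obtains k x z where "k \<in> I" "x \<in> carrier (G k)" "z \<in> carrier (G k)" "U = cls k x" "V = cls k z"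
    "ppow (G k) x \<alpha> = Some z"
proof -
  obtain k x where kx: "(k, x) \<in> U" "ppow (G k) x \<alpha> \<noteq> None"
    using V by (auto simp: direct_limit_def Let_def split: if_splits)
  then obtain z where z: "ppow (G k) x \<alpha> = Some z" by auto
  have k: "k \<in> I" "x \<in> carrier (G k)" "U = cls k x"
    using kx(1) U by (auto elim!: colim_cases simp: mem_cls_iff)
  show ?thesis
  proof (rule that[OF k(1,2) _ k(3) _ z])
    show "z \<in> carrier (G k)"
      by (rule partial_A_group.ppow_closed[OF partial_A_group]) (use k \<alpha> z in auto)
    show "V = cls k z"
      using colim_ppow[OF k(1,2) \<alpha> z] V k by simp
  qed
qed

lemma colim_ppow_cases2:
  assumes U: "U \<in> carrier colim" and \<alpha>: "\<alpha> \<in> carrier A" and V: "ppow colim U \<alpha> = Some V"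
    and W: "W \<in> carrier colim"
  obtains k x z y where "k \<in> I" "x \<in> carrier (G k)" "z \<in> carrier (G k)" "U = cls k x" "V = cls k z"
    "ppow (G k) x \<alpha> = Some z" "y \<in> carrier (G k)" "W = cls k y"
proof -
  obtain i x z where i: "i \<in> I" "x \<in> carrier (G i)" "z \<in> carrier (G i)" "U = cls i x" "V = cls i z"
    "ppow (G i) x \<alpha> = Some z"
    using U \<alpha> V by (rule colim_ppow_cases)
  obtain j y where j: "j \<in> I" "y \<in> carrier (G j)" "W = cls j y"
    using W by (rule colim_cases)
  obtain k where k: "k \<in> I" "i \<preceq> k" "j \<preceq> k"
    using directed i j by metis
  show ?thesis
    by (rule that[of k "f i k x" "f i k z" "f j k y"])
      (use i j k \<alpha> in \<open>auto simp: transition_closed cls_transition transition_ppow\<close>)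
qed

text \<open>The given representative \<open>x\<close> may itself have no power, but at a later index
  it becomes equal to the image of one that does. This makes it possible to collect several powers
  at one index.\<close>

lemma colim_ppow_lift:
  assumes k: "k \<in> I" "x \<in> carrier (G k)" and \<alpha>: "\<alpha> \<in> carrier A"
    and V: "ppow colim (cls k x) \<alpha> = Some V"
  obtains l z where "l \<in> I" "k \<preceq> l" "z \<in> carrier (G l)" "ppow (G l) (f k l x) \<alpha> = Some z" "V = cls l z"
proof -
  obtain i u w where i: "i \<in> I" "u \<in> carrier (G i)" "w \<in> carrier (G i)" "cls k x = cls i u" "V = cls i w"
    "ppow (G i) u \<alpha> = Some w"
    using cls_in_colim[OF k] \<alpha> V by (rule colim_ppow_cases)
  obtain l where l: "l \<in> I" "k \<preceq> l" "i \<preceq> l" "f k l x = f i l u"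
    using cls_eq_transition[OF k i(1,2,4)] .
  show ?thesis
    by (rule that[of l "f i l w"])
      (use i l \<alpha> in \<open>auto simp: transition_closed cls_transition transition_ppow\<close>)
qed

text \<open>For each axiom, the powers and equalities in its hypotheses are realized at a single
  index, the axiom is applied in that member of the system, and \<open>colim_ppow\<close> carries
  the result to the limit.\<close>

lemma partial_A_group_colim: "partial_A_group A colim"
proof -
  \<comment> \<open>Any member of the system shows that \<open>A\<close> is a ring;
    \<open>i0\<close> also serves to represent the unit in the axiom on powers of one.\<close>
  obtain i0 where "i0 \<in> I" using nonempty by auto
  then interpret A: ring A using partial_A_group by (auto simp: partial_A_group_def)
  interpret L: group colim by (rule group_colim)
  note closed = mult_closed inv_closed
  have conj: "inv\<^bsub>colim\<^esub> cls k y \<otimes>\<^bsub>colim\<^esub> cls k x \<otimes>\<^bsub>colim\<^esub> cls k y =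
      cls k (inv\<^bsub>G k\<^esub> y \<otimes>\<^bsub>G k\<^esub> x \<otimes>\<^bsub>G k\<^esub> y)"
    if "k \<in> I" "x \<in> carrier (G k)" "y \<in> carrier (G k)" for k x y
    using that by (simp add: colim_inv colim_mult closed)
  show ?thesis
  proof (unfold_locales, goal_cases)
    case (1 g \<alpha> x) then show ?case by (auto elim!: colim_ppow_cases simp: cls_in_colim)
  next
    case (2 g) then show ?case
      by (auto elim!: colim_cases intro!: colim_ppow partial_A_group.ppow_one[OF partial_A_group])
  next
    case (3 g) then show ?case
      by (auto elim!: colim_cases simp: colim_one
          intro!: colim_ppow partial_A_group.ppow_zero[OF partial_A_group])
  next
    case (4 \<alpha>)
    interpret G0: partial_A_group A "G i0" by (rule partial_A_group) fact
    show ?case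
      using 4 \<open>i0 \<in> I\<close> by (simp add: colim_one[of i0] colim_ppow G0.one_ppow)
  next
    case (5 g \<alpha> \<beta> U V)
    obtain k x u where k: "k \<in> I" "x \<in> carrier (G k)" "u \<in> carrier (G k)" "g = cls k x" "U = cls k u"
      "ppow (G k) x \<alpha> = Some u"
      using 5(1,2,4) by (rule colim_ppow_cases)
    \<comment> \<open>The representative \<open>x\<close> is chosen for its power by \<alpha>; at
      \<open>l\<close> its image also has the power by \<beta>, and the transition preserves the
      first power.\<close>
    obtain l v where l: "l \<in> I" "k \<preceq> l" "v \<in> carrier (G l)" "ppow (G l) (f k l x) \<beta> = Some v" "V = cls l v"
      using colim_ppow_lift[of k x \<beta> V] k 5 by metis
    interpret Gl: partial_A_group A "G l" by (rule partial_A_group) fact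
    have "ppow colim (cls l (f k l x)) (\<alpha> \<oplus>\<^bsub>A\<^esub> \<beta>) = Some (cls l (f k l u \<otimes>\<^bsub>G l\<^esub> v))"
      using k l 5 by (intro colim_ppow Gl.ppow_add) (auto simp: transition_closed transition_ppow)
    also have "cls l (f k l u \<otimes>\<^bsub>G l\<^esub> v) = U \<otimes>\<^bsub>colim\<^esub> V"
      using k l by (simp add: transition_closed cls_transition flip: colim_mult)
    finally show ?case
      using k l by (simp add: cls_transition)
  next
    case (6 g \<alpha> \<beta> U V)
    obtain k x u where k: "k \<in> I" "x \<in> carrier (G k)" "u \<in> carrier (G k)" "g = cls k x" "U = cls k u"
      "ppow (G k) x \<alpha> = Some u"
      using 6(1,2,4) by (rule colim_ppow_cases)
    \<comment> \<open>The lift is applied to \<open>u\<close>, since the second power is taken of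
      the value of the first.\<close>
    obtain l v where l: "l \<in> I" "k \<preceq> l" "v \<in> carrier (G l)" "ppow (G l) (f k l u) \<beta> = Some v" "V = cls l v"
      using colim_ppow_lift[of k u \<beta> V] k 6 by metis
    interpret Gl: partial_A_group A "G l" by (rule partial_A_group) fact
    have "ppow (G l) (f k l x) \<alpha> = Some (f k l u)"
      using k l 6 by (simp add: transition_ppow)
    then have "ppow colim (cls l (f k l x)) (\<alpha> \<otimes>\<^bsub>A\<^esub> \<beta>) = Some (cls l v)"
      using k l 6 by (intro colim_ppow Gl.ppow_mult) (auto simp: transition_closed)
    then show ?case
      using k l by (simp add: cls_transition)
  next
    case (7 g h \<alpha> U)
    obtain k x u y where k: "k \<in> I" "x \<in> carrier (G k)" "u \<in> carrier (G k)" "g = cls k x" "U = cls k u"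
      "ppow (G k) x \<alpha> = Some u" "y \<in> carrier (G k)" "h = cls k y"
      using 7(1,3,4,2) by (rule colim_ppow_cases2)
    interpret Gk: partial_A_group A "G k" by (rule partial_A_group) fact
    show ?case
      using k 7 by (simp add: conj colim_ppow Gk.ppow_conj)
  next
    case (8 g h \<alpha>)
    obtain k x y where k: "k \<in> I" "x \<in> carrier (G k)" "y \<in> carrier (G k)" "g = cls k x" "h = cls k y"
      using 8(1,2) by (rule colim_cases2)
    obtain V where "ppow colim (cls k (inv\<^bsub>G k\<^esub> y \<otimes>\<^bsub>G k\<^esub> x \<otimes>\<^bsub>G k\<^esub> y)) \<alpha> = Some V"
      using 8(4) k by (auto simp: conj)
    \<comment> \<open>The power of the conjugate may become defined only at a later index. There the
      image of the conjugate is the conjugate of the images, and \<open>ppow_conj_defined\<close>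
      applies.\<close>
    then obtain l z where l: "l \<in> I" "k \<preceq> l"
      "ppow (G l) (f k l (inv\<^bsub>G k\<^esub> y \<otimes>\<^bsub>G k\<^esub> x \<otimes>\<^bsub>G k\<^esub> y)) \<alpha> = Some z"
      using k 8(3) colim_ppow_lift[of k "inv\<^bsub>G k\<^esub> y \<otimes>\<^bsub>G k\<^esub> x \<otimes>\<^bsub>G k\<^esub> y" \<alpha> V] closed by metis
    interpret h: group_hom "G k" "G l" "f k l" by (rule transition_group_hom) (use k l in auto)
    interpret Gl: partial_A_group A "G l" by (rule partial_A_group) fact
    have "ppow (G l) (inv\<^bsub>G l\<^esub> f k l y \<otimes>\<^bsub>G l\<^esub> f k l x \<otimes>\<^bsub>G l\<^esub> f k l y) \<alpha> \<noteq> None"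
      using k l by simp
    then have "ppow (G l) (f k l x) \<alpha> \<noteq> None"
      using Gl.ppow_conj_defined k 8(3) h.hom_closed by metis
    then obtain w where "ppow (G l) (f k l x) \<alpha> = Some w" by auto
    then have "ppow colim (cls l (f k l x)) \<alpha> = Some (cls l w)"
      using k l 8(3) by (intro colim_ppow) auto
    then show ?case using k l by (simp add: cls_transition)
  next
    case (9 g h \<alpha> U V)
    obtain i x u y where i: "i \<in> I" "x \<in> carrier (G i)" "u \<in> carrier (G i)" "g = cls i x" "U = cls i u"
      "ppow (G i) x \<alpha> = Some u" "y \<in> carrier (G i)" "h = cls i y"
      using 9(1,3,5,2) by (rule colim_ppow_cases2)
    obtain k v where k: "k \<in> I" "i \<preceq> k" "v \<in> carrier (G k)" "ppow (G k) (f i k y) \<alpha> = Some v" "V = cls k v"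
      using colim_ppow_lift[of i y \<alpha> V] i 9 by metis
    have "cls i (x \<otimes>\<^bsub>G i\<^esub> y) = cls i (y \<otimes>\<^bsub>G i\<^esub> x)"
      using 9 i commutator_eq_one_iff[OF group_colim, of g h] by (simp add: colim_mult)
    then have "cls k (f i k (x \<otimes>\<^bsub>G i\<^esub> y)) = cls k (f i k (y \<otimes>\<^bsub>G i\<^esub> x))"
      using i k closed by (simp add: cls_transition)
    \<comment> \<open>Three successive indices: at \<open>i\<close> the power of \<open>x\<close> is
      defined, at \<open>k\<close> also that of \<open>y\<close>, and at \<open>l\<close> the two
      elements commute.\<close>
    then obtain l where l: "l \<in> I" "k \<preceq> l"
      "f k l (f i k (x \<otimes>\<^bsub>G i\<^esub> y)) = f k l (f i k (y \<otimes>\<^bsub>G i\<^esub> x))"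
      using cls_eq_transition[of k "f i k (x \<otimes>\<^bsub>G i\<^esub> y)" k "f i k (y \<otimes>\<^bsub>G i\<^esub> x)"] i k closed
      by (metis transition_closed)
    have il: "i \<preceq> l" using trans i k l by blast
    interpret il: group_hom "G i" "G l" "f i l" by (rule transition_group_hom) (use i l il in auto)
    interpret Gl: partial_A_group A "G l" by (rule partial_A_group) fact
    have "f i l (x \<otimes>\<^bsub>G i\<^esub> y) = f i l (y \<otimes>\<^bsub>G i\<^esub> x)"
      using i k l closed by (metis transition_comp)
    then have comm: "commutator (G l) (f i l x) (f i l y) = \<one>\<^bsub>G l\<^esub>"
      using i by (simp add: commutator_eq_one_iff[OF group_G[OF l(1)]])
    have px: "ppow (G l) (f i l x) \<alpha> = Some (f i l u)"
      using i l il 9 by (simp add: transition_ppow)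
    have py: "ppow (G l) (f i l y) \<alpha> = Some (f k l v)"
      using transition_ppow[of k l "f i k y" \<alpha> v] i k l 9 by (simp add: transition_closed transition_comp)
    have "ppow colim (cls l (f i l x \<otimes>\<^bsub>G l\<^esub> f i l y)) \<alpha> = Some (cls l (f i l u \<otimes>\<^bsub>G l\<^esub> f k l v))"
      using i 9 l(1) Gl.ppow_commute[OF _ _ _ comm px py] by (intro colim_ppow) auto
    then show ?case
      using i k l il by (simp add: colim_mult[symmetric] transition_closed cls_transition)
  qed
qed

end

section \<open>Embedding the limit into the limit of the completions\<close>

theorem faithful_direct_limit:
  fixes A :: "('a, 'm) ring_scheme" and G :: "'j \<Rightarrow> ('h, 'a) pagroup"
  assumes sys: "direct_system A J r G f" and G: "\<And>j. j \<in> J \<Longrightarrow> G j \<in> faithful_partial_A_groups A"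
  shows "direct_limit J r G f \<in> faithful_partial_A_groups A"
proof -
  interpret G: direct_system A J r G f by fact
  have "\<forall>j\<in>J. \<exists>p :: (('h, 'a) pow_term set, 'a) agroup \<times> ('h \<Rightarrow> ('h, 'a) pow_term set).
      tensor_completion TYPE(('h, 'a) pow_term set) A (G j) (fst p) (snd p) \<and>
      inj_on (snd p) (carrier (G j))"
    using G unfolding faithful_partial_A_groups_def faithful_def by auto
  then obtain p :: "'j \<Rightarrow> (('h, 'a) pow_term set, 'a) agroup \<times> ('h \<Rightarrow> ('h, 'a) pow_term set)" where
    p: "\<And>j. j \<in> J \<Longrightarrow> tensor_completion TYPE(('h, 'a) pow_term set) A (G j) (fst (p j)) (snd (p j))
      \<and> inj_on (snd (p j)) (carrier (G j))"
    by metis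
  define C where "C j = fst (p j)" for j
  define \<iota> where "\<iota> j = snd (p j)" for j
  have C: "tensor_completion TYPE(('h, 'a) pow_term set) A (G j) (C j) (\<iota> j)"
    and inj: "inj_on (\<iota> j) (carrier (G j))" if "j \<in> J" for j
    using p[OF that] by (simp_all add: C_def \<iota>_def)
  note CD = tensor_completionD[OF C]
  have \<iota>_mem: "\<iota> j x \<in> carrier (C j)" if "j \<in> J" "x \<in> carrier (G j)" for j x
    using CD(4)[OF that(1)] that(2) by auto
  \<comment> \<open>The transition map followed by the canonical map of the target is a partial
    A-homomorphism into an A-group, so the universal property extends it to the completion.\<close>
  have "\<exists>\<psi>. \<psi> \<in> A_hom A (C i) (C j) \<and> (\<forall>x\<in>carrier (G i). \<psi> (\<iota> i x) = \<iota> j (f i j x))"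
    if ij: "i \<in> J" "j \<in> J" "r i j" for i j
  proof -
    have "\<iota> j \<circ> f i j \<in> partial_A_hom A (G i) (as_partial (C j))"
      using G.transition[OF ij] CD(2)[OF ij(2)]
      by (auto simp: partial_A_hom_def hom_def Pi_iff)
    then obtain \<psi> where "\<psi> \<in> A_hom A (C i) (C j)"
      "\<And>x. x \<in> carrier (G i) \<Longrightarrow> \<psi> (\<iota> i x) = (\<iota> j \<circ> f i j) x"
      using tensor_completion_lift[OF C[OF ij(1)] CD(1)[OF ij(2)]] by metis
    then show ?thesis by auto
  qed
  then obtain \<psi> where \<psi>: "\<And>i j. \<lbrakk>i \<in> J; j \<in> J; r i j\<rbrakk> \<Longrightarrow> \<psi> i j \<in> A_hom A (C i) (C j)"
    and \<psi>\<iota>: "\<And>i j x. \<lbrakk>i \<in> J; j \<in> J; r i j; x \<in> carrier (G i)\<rbrakk> \<Longrightarrow> \<psi> i j (\<iota> i x) = \<iota> j (f i j x)"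
    by metis
  \<comment> \<open>The canonical image generates the completion, so A-homomorphisms are determined
    by their values on it.\<close>
  have agree: "\<chi> y = \<chi>' y"
    if "i \<in> J" "k \<in> J" "\<chi> \<in> A_hom A (C i) (C k)" "\<chi>' \<in> A_hom A (C i) (C k)" "y \<in> carrier (C i)"
      "\<And>x. x \<in> carrier (G i) \<Longrightarrow> \<chi> (\<iota> i x) = \<chi>' (\<iota> i x)" for i k \<chi> \<chi>' y
    by (rule A_hom_eq_on_generated[OF CD(1) CD(1) CD(4), of i k]) (use that CD(3) in auto)
  \<comment> \<open>The identity and composition laws hold on the canonical images because \<psi>
    extends \<open>f\<close>; \<open>agree\<close> spreads them to the whole completions.\<close>
  have "direct_system A J r (\<lambda>j. as_partial (C j)) \<psi>"
  proof (intro direct_system.intro[OF G.directed_set_axioms] direct_system_axioms.intro, goal_cases)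
    case (1 i) then show ?case by (intro partial_A_group_as_partial CD)
  next
    case (2 i j) then show ?case by (intro A_hom_imp_partial_A_hom \<psi>)
  next
    case (3 i x)
    have "id \<in> A_hom A (C i) (C i)" by (auto simp: A_hom_def hom_def)
    then have "\<psi> i i x = id x"
      using 3 G.refl by (intro agree[of i i "\<psi> i i" id x]) (simp_all add: \<psi> \<psi>\<iota> G.transition_id)
    then show ?case by simp
  next
    case (4 i j k x)
    then have ik: "r i k" using G.trans by blast
    have "(\<psi> j k \<circ> \<psi> i j) x = \<psi> i k x"
      using 4 ik
      by (intro agree[of i k "\<psi> j k \<circ> \<psi> i j" "\<psi> i k" x] A_hom_comp[OF \<psi> \<psi>])
        (simp_all add: \<psi> \<psi>\<iota> G.transition_closed G.transition_comp)
    then show ?case by simp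
  qed
  then interpret C: direct_system A J r "\<lambda>j. as_partial (C j)" \<psi> .
  \<comment> \<open>Every power is defined in each completion, hence for every class, so this limit
    is an A-group.\<close>
  define H where "H = as_total C.colim"
  have H: "A_group A H"
    unfolding H_def
  proof (rule A_group_as_total[OF C.partial_A_group_colim])
    fix U \<alpha> assume "U \<in> carrier C.colim" "\<alpha> \<in> carrier A"
    then show "ppow C.colim U \<alpha> \<noteq> None"
      by (auto elim!: C.colim_cases simp: C.colim_ppow)
  qed
  \<comment> \<open>As in \<open>direct_limit\<close>, a union over all representatives replaces a
    choice of one; \<open>\<phi>_cls\<close> shows that they all contribute the same class.\<close>
  define \<phi> where "\<phi> U = (\<Union>(i, x)\<in>U. C.cls i (\<iota> i x))" for U
  have \<phi>_cls: "\<phi> (G.cls i x) = C.cls i (\<iota> i x)" if i: "i \<in> J" "x \<in> carrier (G i)" for i x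
  proof -
    have "C.cls j (\<iota> j y) = C.cls i (\<iota> i x)" if "(j, y) \<in> G.cls i x" for j y
    proof -
      have j: "j \<in> J" "y \<in> carrier (G j)" "G.cls j y = G.cls i x"
        using that i by (auto simp: G.mem_cls_iff)
      obtain k where k: "k \<in> J" "r j k" "r i k" "f j k y = f i k x"
        using G.cls_eq_transition[OF j(1,2) i j(3)] .
      have "\<psi> j k (\<iota> j y) = \<psi> i k (\<iota> i x)"
        using i j k by (simp add: \<psi>\<iota>)
      then show ?thesis
        using i j k by (subst C.cls_eq_iff) (auto simp: \<iota>_mem)
    qed
    moreover have "(i, x) \<in> G.cls i x" using i by (simp add: G.mem_cls_iff)
    ultimately show ?thesis unfolding \<phi>_def by blast
  qed
  have "\<phi> \<in> hom G.colim C.colim"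
  proof (rule homI)
    fix U assume "U \<in> carrier G.colim"
    then show "\<phi> U \<in> carrier C.colim"
      by (auto elim!: G.colim_cases simp: \<phi>_cls C.cls_in_colim \<iota>_mem)
  next
    fix U V assume "U \<in> carrier G.colim" "V \<in> carrier G.colim"
    then obtain k x y where k: "k \<in> J" "x \<in> carrier (G k)" "y \<in> carrier (G k)"
      "U = G.cls k x" "V = G.cls k y"
      by (rule G.colim_cases2)
    interpret Gk: group "G k" by (rule G.group_G[OF k(1)])
    have "\<iota> k (x \<otimes>\<^bsub>G k\<^esub> y) = \<iota> k x \<otimes>\<^bsub>C k\<^esub> \<iota> k y"
      using CD(2)[OF k(1)] k by (auto simp: partial_A_hom_def hom_def)
    then show "\<phi> (U \<otimes>\<^bsub>G.colim\<^esub> V) = \<phi> U \<otimes>\<^bsub>C.colim\<^esub> \<phi> V"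
      using k by (simp add: G.colim_mult C.colim_mult \<phi>_cls \<iota>_mem)
  qed
  moreover have "ppow C.colim (\<phi> U) \<alpha> = Some (\<phi> V)"
    if U: "U \<in> carrier G.colim" "\<alpha> \<in> carrier A" "ppow G.colim U \<alpha> = Some V" for U \<alpha> V
  proof -
    \<comment> \<open>The power is realized at the index of a representative, where the canonical
      map preserves it.\<close>
    obtain k x z where k: "k \<in> J" "x \<in> carrier (G k)" "z \<in> carrier (G k)" "U = G.cls k x"
      "V = G.cls k z" "ppow (G k) x \<alpha> = Some z"
      using U by (rule G.colim_ppow_cases)
    have "ppow (as_partial (C k)) (\<iota> k x) \<alpha> = Some (\<iota> k z)"
      using CD(2)[OF k(1)] k(2) U(2) k(6) by (rule partial_A_hom_ppow)
    then show ?thesis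
      using k U by (simp only: \<phi>_cls) (rule C.colim_ppow, auto simp: \<iota>_mem)
  qed
  ultimately have \<phi>: "\<phi> \<in> partial_A_hom A G.colim (as_partial H)"
    by (auto simp: partial_A_hom_as_partial_iff H_def hom_def)
  have "inj_on \<phi> (carrier G.colim)"
  proof (rule inj_onI)
    fix U V assume UV: "U \<in> carrier G.colim" "V \<in> carrier G.colim" and eq: "\<phi> U = \<phi> V"
    from UV obtain k x y where k: "k \<in> J" "x \<in> carrier (G k)" "y \<in> carrier (G k)"
      "U = G.cls k x" "V = G.cls k y"
      by (rule G.colim_cases2)
    have "C.cls k (\<iota> k x) = C.cls k (\<iota> k y)"
      using eq k by (simp add: \<phi>_cls)
    \<comment> \<open>Equal classes agree only after a transition to some \<open>l\<close>; there
      the intertwining of \<psi> and \<open>f\<close> turns this into an equality of canonical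
      images of elements of \<open>G l\<close>.\<close>
    then obtain l where l: "l \<in> J" "r k l" "\<psi> k l (\<iota> k x) = \<psi> k l (\<iota> k y)"
      using C.cls_eq_transition[of k "\<iota> k x" k "\<iota> k y"] k by (auto simp: \<iota>_mem)
    then have "\<iota> l (f k l x) = \<iota> l (f k l y)"
      using k by (simp add: \<psi>\<iota>)
    then have "f k l x = f k l y"
      using inj[OF l(1)] k l G.transition_closed by (auto dest: inj_onD)
    then show "U = V"
      using k l G.cls_transition by metis
  qed
  then show ?thesis
    using faithfulI[OF G.partial_A_group_colim H \<phi>] G.partial_A_group_colim
    by (simp add: faithful_partial_A_groups_def)
qed

theorem proposition1:
  fixes A :: "('a, 'm) ring_scheme"
  assumes "ring A"
  shows "(\<forall>(I :: 'i set) (G :: 'i \<Rightarrow> ('g, 'a) pagroup).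
            (\<forall>i\<in>I. G i \<in> faithful_partial_A_groups A) \<longrightarrow>
            direct_sum I G \<in> faithful_partial_A_groups A) \<and>
         (\<forall>(J :: 'j set) r (G :: 'j \<Rightarrow> ('h, 'a) pagroup) f.
            direct_system A J r G f \<and> (\<forall>j\<in>J. G j \<in> faithful_partial_A_groups A) \<longrightarrow>
            direct_limit J r G f \<in> faithful_partial_A_groups A)"
  by (intro conjI allI impI faithful_direct_sum[OF assms]) (auto intro: faithful_direct_limit)

end
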